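(* Let $\boldsymbol d$ be a degree sequence on $W$, let $X,L\subseteq K_n$ with $X\cap L=\boldsymbol{\emptyset}$, and let $G\sim\mathcal G_{\boldsymbol d}(\boldsymbol{\emptyset},L)$. Let $e_1,\dots,e_{m(X)}$ be an enumeration of the edges of $X$, $X_0=\boldsymbol{\emptyset}$ and $X_i=X_0+e_1+\dots+e_i$ for $1\le i\le m(X)$. Let $\boldsymbol x$ be the degree sequence of $X$. (A) If $f(\boldsymbol d,X_{i-1},L,e_i)>0$ for all $i$, then $$\mathbb P(X\subseteq G)\le\frac{\prod_{j\in W}[d_j]_{x_j}}{2^{m(X)}[m(G)]_{m(X)}}\cdot\prod_{i=1}^{m(X)}\frac{1}{f(\boldsymbol d,X_{i-1},L,e_i)}.$$ (B) If $g(\boldsymbol d,X_{i-1},L,e_i)>0$ for all $i$, then $$\mathbb P(X\subseteq G)\ge\frac{\prod_{j\in W}[d_j]_{x_j}}{2^{m(X)}[m(G)]_{m(X)}}\cdot\prod_{i=1}^{m(X)}\frac{g(\boldsymbol d,X_{i-1},L,e_i)}{\phi(\boldsymbol d,X)},$$ where $\phi(\boldsymbol d,X)=1+\dfrac{\frac{1}{m(X)}\sum_{uv\in X}d_ud_v}{2m(G)-2m(X)}$.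
   Context: $K_n$ is the complete graph on $W=\{w_1,\dots,w_n\}$; graphs are subgraphs of $K_n$ on vertex set $W$, identified with their edge sets; $\boldsymbol{\emptyset}$ is the edgeless graph. For a graph $H$ (resp. $L$, $X$), $\boldsymbol h=(h_w)_{w\in W}$ (resp. $\boldsymbol l$, $\boldsymbol x$) is its degree sequence and $m(H)$ its number of edges; $H+uv$ is $H$ with the edge $uv$ added. For an integer vector $\boldsymbol d$ and edge-disjoint $X,Y\subseteq K_n$, $\mathcal G_{\boldsymbol d}(X,Y)$ is the set of graphs $G\subseteq K_n$ with degree sequence $\boldsymbol d$, $X\subseteq G$ and $G\cap Y=\boldsymbol{\emptyset}$; it is assumed nonempty, and $G\sim\mathcal G_{\boldsymbol d}(X,Y)$ means $G$ is uniform on it. $m(G):=\frac12\sum_{w\in W}d_w$. $[x]_i=\prod_{j=0}^{i-1}(x-j)$, $[x]_0=1$. Degree sum function: for a vector $\boldsymbol g=(g_w)_{w\in W'}$ of nonnegative integers indexed by a finite set $W'$ and $A\subsetneq W'$, let $N=|W'|-|A|$, let $g_{i_1}\ge\dots\ge g_{i_N}$ be the entries at vertices of $W'\setminus A$ in nonincreasing order, $L^A(\boldsymbol g,k)=\sum_{j=1}^k g_{i_j}$, and $D^A(\boldsymbol g,x)=g_{i_1}x$ if $x<1$; $=g_{i_{k+1}}(x-k)+L^A(\boldsymbol g,k)$ if $x\in[k,k+1)$, $k\in\{1,\dots,N-1\}$; $=L^A(\boldsymbol g,N)$ if $x\ge N$. Write $D(\boldsymbol g,x)=D^{\emptyset}(\boldsymbol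 g,x)$ and $D_H(x)=D(\boldsymbol d-\boldsymbol h,x)$. $\alpha$-value: for vectors $\boldsymbol n,\boldsymbol l$ on $W_1$ and $\boldsymbol g,\boldsymbol h$ on $W_2$ and $w\in W_2$, $\alpha_w(\boldsymbol n,\boldsymbol l,\boldsymbol g,\boldsymbol h)=\dfrac{D(\boldsymbol n+\boldsymbol l,\max\{g_w-h_w,1\})}{\max\{g_w-h_w,1\}}$. For $H\cap L=\boldsymbol{\emptyset}$ and $uv\notin H\cup L$: $f(\boldsymbol d,H,L,uv)=1-\dfrac{D_H(d_u+l_u)+D_H(d_v+l_v)}{2m(G)-2m(H)}$, $g(\boldsymbol d,H,L,uv)=1-\dfrac{D_H(\alpha_u(\boldsymbol d,\boldsymbol l,\boldsymbol d,\boldsymbol h)+2)+D_H(\alpha_v(\boldsymbol d,\boldsymbol l,\boldsymbol d,\boldsymbol h)+2)}{2m(G)-2m(H)}$. *)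

theory Defs
  imports "HOL-Probability.Probability"
begin

text \<open>Simple graphs on a vertex set are identified with their edge sets; an edge is a
  two-element set of vertices.\<close>

definition complete_graph :: "'a set \<Rightarrow> 'a set set" where
  "complete_graph W = {e. e \<subseteq> W \<and> card e = 2}"

definition deg :: "'a set set \<Rightarrow> 'a \<Rightarrow> nat" where
  "deg H w = card {e \<in> H. w \<in> e}"

definition graphs_with_degrees ::
  "'a set \<Rightarrow> ('a \<Rightarrow> int) \<Rightarrow> 'a set set \<Rightarrow> 'a set set \<Rightarrow> 'a set set set" where
  "graphs_with_degrees W d X Y =
     {G. G \<subseteq> complete_graph W \<and> (\<forall>w\<in>W. int (deg G w) = d w) \<and> X \<subseteq> G \<and> G \<inter> Y = {}}"

definition num_edges :: "'a set \<Rightarrow> ('a \<Rightarrow> int) \<Rightarrow> real" where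
  "num_edges W d = (\<Sum>w\<in>W. real_of_int (d w)) / 2"

definition falling_fact :: "real \<Rightarrow> nat \<Rightarrow> real" where
  "falling_fact x i = (\<Prod>j<i. x - real j)"

definition decreasing_entries :: "'a set \<Rightarrow> 'a set \<Rightarrow> ('a \<Rightarrow> int) \<Rightarrow> int list" where
  "decreasing_entries W A g = rev (sorted_list_of_multiset (image_mset g (mset_set (W - A))))"

definition top_sum :: "'a set \<Rightarrow> 'a set \<Rightarrow> ('a \<Rightarrow> int) \<Rightarrow> nat \<Rightarrow> int" where
  "top_sum W A g k = sum_list (take k (decreasing_entries W A g))"

text \<open>The degree sum function \<open>D\<^sup>A(g, x)\<close>. List positions start at 0, so position \<open>k\<close>
  holds the \<open>(k+1)\<close>-st largest entry. It is meant for nonnegative vectors (and proper subsets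
  \<open>A\<close> of \<open>W\<close>); integer entries are admitted so that differences \<open>d - h\<close> are not truncated.\<close>

definition deg_sum_avoiding :: "'a set \<Rightarrow> 'a set \<Rightarrow> ('a \<Rightarrow> int) \<Rightarrow> real \<Rightarrow> real" where
  "deg_sum_avoiding W A g x =
     (let N = card W - card A;
          k = nat \<lfloor>x\<rfloor>
      in if x < 1 then real_of_int (decreasing_entries W A g ! 0) * x
         else if x < real N then
           real_of_int (decreasing_entries W A g ! k) * (x - real k)
             + real_of_int (top_sum W A g k)
         else real_of_int (top_sum W A g N))"

definition deg_sum :: "'a set \<Rightarrow> ('a \<Rightarrow> int) \<Rightarrow> real \<Rightarrow> real" where
  "deg_sum W g x = deg_sum_avoiding W {} g x"

definition deg_sum_residual ::
  "'a set \<Rightarrow> ('a \<Rightarrow> int) \<Rightarrow> 'a set set \<Rightarrow> real \<Rightarrow> real" where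
  "deg_sum_residual W d H x = deg_sum W (\<lambda>w. d w - int (deg H w)) x"

text \<open>The \<open>\<alpha>\<close>-value; the vectors \<open>n\<close> and \<open>l\<close> live on \<open>W\<^sub>1\<close>, while \<open>g\<close> and \<open>h\<close> only need to
  be defined at \<open>w\<close>.\<close>

definition alpha_value ::
  "'a set \<Rightarrow> ('a \<Rightarrow> int) \<Rightarrow> ('a \<Rightarrow> int) \<Rightarrow> ('b \<Rightarrow> int) \<Rightarrow> ('b \<Rightarrow> int) \<Rightarrow> 'b \<Rightarrow> real" where
  "alpha_value W\<^sub>1 n l g h w =
     deg_sum W\<^sub>1 (\<lambda>v. n v + l v) (real_of_int (max (g w - h w) 1))
       / real_of_int (max (g w - h w) 1)"

text \<open>For an edge \<open>e = uv\<close>, sums and products over \<open>w \<in> e\<close> have exactly the two terms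
  for \<open>w = u\<close> and \<open>w = v\<close>.\<close>

definition f_val ::
  "'a set \<Rightarrow> ('a \<Rightarrow> int) \<Rightarrow> 'a set set \<Rightarrow> 'a set set \<Rightarrow> 'a set \<Rightarrow> real" where
  "f_val W d H L e =
     1 - (\<Sum>w\<in>e. deg_sum_residual W d H (real_of_int (d w + int (deg L w))))
           / (2 * num_edges W d - 2 * real (card H))"

definition g_val ::
  "'a set \<Rightarrow> ('a \<Rightarrow> int) \<Rightarrow> 'a set set \<Rightarrow> 'a set set \<Rightarrow> 'a set \<Rightarrow> real" where
  "g_val W d H L e =
     1 - (\<Sum>w\<in>e. deg_sum_residual W d H
              (alpha_value W d (\<lambda>v. int (deg L v)) d (\<lambda>v. int (deg H v)) w + 2))
           / (2 * num_edges W d - 2 * real (card H))"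

definition phi_val :: "'a set \<Rightarrow> ('a \<Rightarrow> int) \<Rightarrow> 'a set set \<Rightarrow> real" where
  "phi_val W d X =
     1 + (1 / real (card X) * (\<Sum>e\<in>X. \<Prod>w\<in>e. real_of_int (d w)))
           / (2 * num_edges W d - 2 * real (card X))"

end

(* D(g, x) is the minimum over t >= 0 of t x + \<Sum> max(g_w - t, 0), which bounds sums of residual
   degrees over vertex sets of bounded (average) size.  For an edge uv, let P and N be the sets of
   graphs containing H and avoiding L that do and do not contain uv.  Counting the pairs related by
   the switching uv, xy -> ux, vy bounds |P| / |N| from above; the switching
   ux, vy, pq -> uv, xp, yq bounds it from below.  Adding the edges of X one at a time and
   multiplying the resulting ratios gives (A), and (B) up to the factor
   \<Prod> (1 + q_i) with q_i <= d_u d_v / (2 m(G) - 2 m(X)) for e_i = uv, which AM-GM compares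
   with \<phi>^m(X).  If m(X) = m(G) then \<phi> is 1 (division by zero), but then either the right-hand
   side of (B) vanishes or the last value of g is negative. *)
theory Submission
  imports Defs
begin

subsection \<open>The degree sum function\<close>

text \<open>Switched edges are taken from G - H, so that H survives, and new edges must avoid G and
  L. From a graph in P, an arc xy of G - H is unusable only if x is u or is joined to u in G or L,
  or likewise for y and v; D_H(d_u + l_u) and D_H(d_v + l_v) bound the loss. Reversing this
  switching would require xy to be a non-edge, which may fail for all residual neighbours x of u and
  y of v. The third edge pq makes room: for fixed x and y, the unusable arcs pq can be counted as
  before. The price is that d_x + l_x now enters for neighbours x of u, and this is controlled only
  on average; since D is a minimum of affine functions, an average suffices, and alpha bounds it.
  With q_i the ratio of consecutive main terms, the second switching gives q_i g_i |N| \<le> |P|,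
  whereas the induction needs |P| against |P| + |N|. Passing from one to the other costs the factor
  1 + q_i.\<close>

lemma of_int_sum_list: "of_int (sum_list xs) = sum_list (map of_int xs)"
  by (induction xs) auto

lemma sum_positive_parts_conv_list:
  assumes "finite W"
  shows "(\<Sum>w\<in>W. max (real_of_int (g w) - t) 0)
    = sum_list (map (\<lambda>y. max (real_of_int y - t) 0) (decreasing_entries W {} g))"
proof -
  have "mset (decreasing_entries W {} g) = image_mset g (mset_set W)"
    by (simp add: decreasing_entries_def)
  then show ?thesis
    by (simp add: sum_unfold_sum_mset multiset.map_comp comp_def flip: sum_mset_sum_list)
qed

text \<open>Linear programming duality: for \<open>x \<ge> 0\<close>, \<open>D(g, x)\<close> is the minimum over \<open>t \<ge> 0\<close> of
  \<open>t x + \<Sum> max (g\<^sub>w - t, 0)\<close>, attained at the entry in position \<open>\<lfloor>x\<rfloor>\<close>.\<close>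

lemma deg_sum_dual:
  assumes "finite W" "W \<noteq> {}" "\<And>w. w \<in> W \<Longrightarrow> 0 \<le> g w" "0 \<le> x"
  obtains t where "0 \<le> t"
    and "deg_sum W g x = t * x + (\<Sum>w\<in>W. max (real_of_int (g w) - t) 0)"
proof -
  define xs where "xs = decreasing_entries W {} g"
  define k where "k = nat \<lfloor>x\<rfloor>"
  have mset: "mset xs = image_mset g (mset_set W)"
    by (simp add: xs_def decreasing_entries_def)
  have len: "length xs = card W"
    using arg_cong[OF mset, of size] by simp
  have set: "set xs = g ` W"
    using arg_cong[OF mset, of set_mset] assms(1) by simp
  have nonneg: "0 \<le> y" if "y \<in> set xs" for y
    using that set assms(3) by auto
  have sorted: "sorted (rev xs)"
    by (simp add: xs_def decreasing_entries_def)
  have dec: "xs ! j \<le> xs ! i" if "i \<le> j" "j < length xs" for i j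
    using sorted_rev_nth_mono[OF sorted that] by simp
  have "card W > 0"
    using assms by (simp add: card_gt_0_iff)
  show thesis
  proof (cases "x < real (card W)")
    case True
    then have k: "k < length xs"
      using \<open>0 \<le> x\<close> unfolding k_def len by linarith
    define t where "t = real_of_int (xs ! k)"
    \<comment> \<open>For x < 1 the first clause of the definition is the middle one with k = 0 and
      an empty top sum, so one computation covers both.\<close>
    have "x < 1 \<Longrightarrow> k = 0"
      using \<open>0 \<le> x\<close> unfolding k_def by linarith
    then have D: "deg_sum W g x = t * (x - real k) + real_of_int (sum_list (take k xs))"
      using True by (auto simp: deg_sum_def deg_sum_avoiding_def Let_def top_sum_def t_def
          simp flip: xs_def k_def)
    \<comment> \<open>The first k entries are at least t and contribute y - t; the others are at
      most t and vanish. The subtracted k t is the difference between t x and t (x - k).\<close>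
    have "(\<Sum>w\<in>W. max (real_of_int (g w) - t) 0)
        = sum_list (map (\<lambda>y. max (real_of_int y - t) 0) (take k xs @ drop k xs))"
      using sum_positive_parts_conv_list[OF assms(1)] by (simp add: xs_def)
    also have "\<dots> = sum_list (map (\<lambda>y. max (real_of_int y - t) 0) (take k xs))
        + sum_list (map (\<lambda>y. max (real_of_int y - t) 0) (drop k xs))"
      by (simp only: map_append sum_list_append)
    also have "map (\<lambda>y. max (real_of_int y - t) 0) (drop k xs) = map (\<lambda>_. 0) (drop k xs)"
      using dec by (auto simp: t_def in_set_conv_nth)
    also have "map (\<lambda>y. max (real_of_int y - t) 0) (take k xs)
        = map (\<lambda>y. real_of_int y - t) (take k xs)"
    proof (rule map_cong)
      fix y assume "y \<in> set (take k xs)"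
      then obtain j where "j < k" "y = xs ! j"
        using k by (auto simp: in_set_conv_nth)
      then show "max (real_of_int y - t) 0 = real_of_int y - t"
        using dec[of j k] k by (simp add: t_def)
    qed simp
    also have "sum_list \<dots> = real_of_int (sum_list (take k xs)) - real k * t"
      using k by (simp add: sum_list_subtractf sum_list_triv of_int_sum_list)
    finally have "deg_sum W g x = t * x + (\<Sum>w\<in>W. max (real_of_int (g w) - t) 0)"
      by (simp add: D algebra_simps)
    moreover have "0 \<le> t"
      using nonneg k by (simp add: t_def)
    ultimately show thesis
      using that by blast
  next
    case False
    then have "deg_sum W g x = real_of_int (sum_list xs)"
      using \<open>card W > 0\<close> by (auto simp: deg_sum_def deg_sum_avoiding_def Let_def top_sum_def len
          simp flip: xs_def)
    also have "sum_list xs = (\<Sum>w\<in>W. g w)"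
      using mset by (simp add: sum_unfold_sum_mset flip: sum_mset_sum_list)
    \<comment> \<open>Past the last entry D is constant, so the optimal slope is t = 0, and
      nonnegative entries equal their positive parts.\<close>
    also have "real_of_int \<dots> = 0 * x + (\<Sum>w\<in>W. max (real_of_int (g w) - 0) 0)"
      using assms(3) by (simp cong: sum.cong)
    finally show thesis
      using that[of 0] by simp
  qed
qed

text \<open>Weak duality: every w in \<open>S\<close> contributes at most t + max (g w - t) 0. The
  bound is affine in \<open>card S\<close>, which allows averaging over several sets.\<close>

lemma sum_le_dual:
  fixes g :: "'a \<Rightarrow> int"
  assumes "finite W" "S \<subseteq> W"
  shows "(\<Sum>w\<in>S. real_of_int (g w)) \<le> t * real (card S) + (\<Sum>w\<in>W. max (real_of_int (g w) - t) 0)"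
proof -
  have "(\<Sum>w\<in>S. real_of_int (g w)) = t * real (card S) + (\<Sum>w\<in>S. real_of_int (g w) - t)"
    by (simp add: sum_subtractf)
  also have "(\<Sum>w\<in>S. real_of_int (g w) - t) \<le> (\<Sum>w\<in>S. max (real_of_int (g w) - t) 0)"
    by (intro sum_mono) simp
  also have "\<dots> \<le> (\<Sum>w\<in>W. max (real_of_int (g w) - t) 0)"
    using assms by (intro sum_mono2) auto
  finally show ?thesis by simp
qed

text \<open>Jensen's inequality for the concave function \<open>D(g, \<cdot>)\<close>.\<close>

lemma sum_sum_le_deg_sum:
  assumes "finite W" "W \<noteq> {}" "\<And>w. w \<in> W \<Longrightarrow> 0 \<le> g w" "0 \<le> x"
    and "\<And>i. i \<in> I \<Longrightarrow> S i \<subseteq> W"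
    and "(\<Sum>i\<in>I. real (card (S i))) \<le> real (card I) * x"
  shows "(\<Sum>i\<in>I. \<Sum>w\<in>S i. real_of_int (g w)) \<le> real (card I) * deg_sum W g x"
proof -
  \<comment> \<open>One t, optimal for x, serves all sets \<open>S i\<close>. The bounds are then
    affine with a common slope, so only the average size matters, and t \<ge> 0 lets it be replaced
    by x.\<close>
  obtain t where t: "0 \<le> t"
    "deg_sum W g x = t * x + (\<Sum>w\<in>W. max (real_of_int (g w) - t) 0)"
    using deg_sum_dual assms(1-4) by blast
  define C where "C = (\<Sum>w\<in>W. max (real_of_int (g w) - t) 0)"
  have "(\<Sum>i\<in>I. \<Sum>w\<in>S i. real_of_int (g w)) \<le> (\<Sum>i\<in>I. t * real (card (S i)) + C)"
    unfolding C_def by (intro sum_mono sum_le_dual assms)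
  also have "\<dots> = t * (\<Sum>i\<in>I. real (card (S i))) + real (card I) * C"
    by (simp add: sum.distrib sum_distrib_left)
  also have "\<dots> \<le> t * (real (card I) * x) + real (card I) * C"
    using assms(6) t(1) by (intro add_right_mono mult_left_mono)
  finally show ?thesis
    by (simp add: t(2) C_def algebra_simps)
qed

lemma sum_le_deg_sum:
  assumes "finite W" "W \<noteq> {}" "\<And>w. w \<in> W \<Longrightarrow> 0 \<le> g w" "S \<subseteq> W" "real (card S) \<le> x"
  shows "(\<Sum>w\<in>S. real_of_int (g w)) \<le> deg_sum W g x"
proof -
  have "0 \<le> x"
    using assms(5) by (meson of_nat_0_le_iff order_trans)
  with sum_sum_le_deg_sum[of W g x "{()}" "\<lambda>_. S"] assms show ?thesis
    by simp
qed

lemma deg_sum_nonneg: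
  assumes "finite W" "W \<noteq> {}" "\<And>w. w \<in> W \<Longrightarrow> 0 \<le> g w" "0 \<le> x"
  shows "0 \<le> deg_sum W g x"
  using sum_le_deg_sum[of W g "{}" x, OF assms(1-3)] assms(4) by simp

subsection \<open>Degrees and arcs\<close>

definition neighbours :: "'a set set \<Rightarrow> 'a \<Rightarrow> 'a set" where
  "neighbours F x = {y. {x, y} \<in> F}"

text \<open>Edges with an orientation: a switching has to know which end of an edge is joined to u
  and which to v. Each edge yields two arcs, which matches the denominators 2m(G) - 2m(H).\<close>

definition arcs :: "'a set set \<Rightarrow> ('a \<times> 'a) set" where
  "arcs F = {(x, y). {x, y} \<in> F}"

lemma finite_complete_graph: "finite W \<Longrightarrow> finite (complete_graph W)"
  unfolding complete_graph_def by simp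

lemma edge_in_complete_graph: "{x, y} \<in> complete_graph W \<longleftrightarrow> x \<in> W \<and> y \<in> W \<and> x \<noteq> y"
  by (cases "x = y") (auto simp: complete_graph_def)

lemma complete_graphE:
  assumes "e \<in> complete_graph W"
  obtains x y where "e = {x, y}" "x \<in> W" "y \<in> W" "x \<noteq> y"
  using assms by (auto simp: complete_graph_def card_2_iff)

lemma edgeD:
  assumes "F \<subseteq> complete_graph W" "{x, y} \<in> F"
  shows "x \<in> W" "y \<in> W" "x \<noteq> y"
  using subsetD[OF assms] by (simp_all add: edge_in_complete_graph)

lemma deg_insert: "finite F \<Longrightarrow> a \<notin> F \<Longrightarrow> deg (insert a F) w = deg F w + of_bool (w \<in> a)"
proof -
  assume "finite F" "a \<notin> F"
  have "{b \<in> insert a F. w \<in> b} = (if w \<in> a then insert a {b \<in> F. w \<in> b} else {b \<in> F. w \<in> b})"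
    by auto
  then show ?thesis
    using \<open>finite F\<close> \<open>a \<notin> F\<close> by (simp add: deg_def)
qed

lemma deg_remove: "finite F \<Longrightarrow> a \<in> F \<Longrightarrow> deg F w = deg (F - {a}) w + of_bool (w \<in> a)"
  using deg_insert[of "F - {a}" a w] by (simp add: insert_absorb)

lemma deg_diff: "finite G \<Longrightarrow> H \<subseteq> G \<Longrightarrow> int (deg (G - H) w) = int (deg G w) - int (deg H w)"
proof -
  assume "finite G" "H \<subseteq> G"
  have "{e \<in> G - H. w \<in> e} = {e \<in> G. w \<in> e} - {e \<in> H. w \<in> e}"
    by auto
  moreover have "{e \<in> H. w \<in> e} \<subseteq> {e \<in> G. w \<in> e}"
    using \<open>H \<subseteq> G\<close> by auto
  ultimately show ?thesis
    using \<open>finite G\<close> unfolding deg_def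
    by (simp add: card_Diff_subset finite_subset card_mono)
qed

lemma deg_mono: "finite G \<Longrightarrow> H \<subseteq> G \<Longrightarrow> deg H w \<le> deg G w"
  unfolding deg_def by (rule card_mono) auto

lemma neighbours_subset: "F \<subseteq> complete_graph W \<Longrightarrow> neighbours F x \<subseteq> W - {x}"
  by (auto simp: neighbours_def dest: edgeD)

lemma card_neighbours:
  assumes "F \<subseteq> complete_graph W"
  shows "card (neighbours F x) = deg F x"
  unfolding deg_def
proof (rule bij_betw_same_card)
  show "bij_betw (\<lambda>y. {x, y}) (neighbours F x) {e \<in> F. x \<in> e}"
  proof (rule bij_betw_imageI)
    show "inj_on (\<lambda>y. {x, y}) (neighbours F x)"
      by (auto simp: inj_on_def doubleton_eq_iff)
    have "e \<in> (\<lambda>y. {x, y}) ` neighbours F x" if "e \<in> F" "x \<in> e" for e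
    proof -
      obtain p q where "e = {p, q}"
        using \<open>e \<in> F\<close> assms by (blast elim: complete_graphE)
      with that show ?thesis
        by (auto simp: neighbours_def insert_commute image_iff)
    qed
    then show "(\<lambda>y. {x, y}) ` neighbours F x = {e \<in> F. x \<in> e}"
      by (auto simp: neighbours_def)
  qed
qed

lemma finite_neighbours: "finite W \<Longrightarrow> F \<subseteq> complete_graph W \<Longrightarrow> finite (neighbours F x)"
  by (meson finite_Diff finite_subset neighbours_subset)

lemma finite_arcs: "finite W \<Longrightarrow> F \<subseteq> complete_graph W \<Longrightarrow> finite (arcs F)"
  by (rule finite_subset[of _ "W \<times> W"]) (auto simp: arcs_def dest: edgeD)

lemma card_arcs_from:
  assumes "finite W" "F \<subseteq> complete_graph W" "finite S"
  shows "card {(x, y) \<in> arcs F. x \<in> S} = (\<Sum>x\<in>S. deg F x)"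
proof -
  have "{(x, y) \<in> arcs F. x \<in> S} = Sigma S (neighbours F)"
    by (auto simp: arcs_def neighbours_def)
  then show ?thesis
    using assms by (simp add: finite_neighbours card_neighbours)
qed

lemma card_arcs_to:
  assumes "finite W" "F \<subseteq> complete_graph W" "finite S"
  shows "card {(x, y) \<in> arcs F. y \<in> S} = (\<Sum>y\<in>S. deg F y)"
proof -
  have "{(x, y) \<in> arcs F. y \<in> S} = prod.swap ` {(x, y) \<in> arcs F. x \<in> S}"
    by (auto simp: arcs_def insert_commute image_iff)
  then show ?thesis
    using card_arcs_from[OF assms] by (simp add: card_image)
qed

lemma card_arcs_sum_deg:
  assumes "finite W" "F \<subseteq> complete_graph W"
  shows "card (arcs F) = (\<Sum>w\<in>W. deg F w)"
proof -
  have "{(x, y) \<in> arcs F. x \<in> W} = arcs F"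
    using assms by (auto simp: arcs_def dest: edgeD)
  then show ?thesis
    using card_arcs_from[OF assms, of W] assms by simp
qed

lemma sum_deg:
  assumes "finite W" "F \<subseteq> complete_graph W"
  shows "(\<Sum>w\<in>W. deg F w) = 2 * card F"
proof -
  have finF: "finite F"
    using assms finite_complete_graph finite_subset by blast
  have "(\<Sum>w\<in>W. deg F w) = (\<Sum>w\<in>W. \<Sum>e\<in>F. of_bool (w \<in> e))"
    using finF by (simp add: deg_def of_bool_def sum.If_cases Int_def)
  also have "\<dots> = (\<Sum>e\<in>F. \<Sum>w\<in>W. of_bool (w \<in> e))"
    by (rule sum.swap)
  also have "\<dots> = (\<Sum>e\<in>F. 2)"
  proof (rule sum.cong)
    fix e assume "e \<in> F"
    then have "W \<inter> {w. w \<in> e} = e" "card e = 2"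
      using assms by (auto simp: complete_graph_def)
    then show "(\<Sum>w\<in>W. of_bool (w \<in> e)) = (2 :: nat)"
      using assms by (simp add: of_bool_def sum.If_cases)
  qed simp
  finally show ?thesis by simp
qed

text \<open>A union bound. In the three-edge switching \<open>S\<close> and \<open>T\<close> contain
  x and y themselves, and this cost enters the argument of D in g.\<close>

lemma card_arcs_avoiding:
  assumes "finite W" "F \<subseteq> complete_graph W" "finite S" "finite T"
  shows "real (card (arcs F)) - (\<Sum>x\<in>S. real (deg F x)) - (\<Sum>y\<in>T. real (deg F y))
    \<le> real (card {(x, y) \<in> arcs F. x \<notin> S \<and> y \<notin> T})"
proof -
  have "arcs F = {(x, y) \<in> arcs F. x \<notin> S \<and> y \<notin> T} \<union>
      ({(x, y) \<in> arcs F. x \<in> S} \<union> {(x, y) \<in> arcs F. y \<in> T})"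
    by auto
  then have "card (arcs F) \<le> card {(x, y) \<in> arcs F. x \<notin> S \<and> y \<notin> T} +
      card ({(x, y) \<in> arcs F. x \<in> S} \<union> {(x, y) \<in> arcs F. y \<in> T})"
    using card_Un_le by (rule ord_eq_le_trans[OF arg_cong])
  also have "card ({(x, y) \<in> arcs F. x \<in> S} \<union> {(x, y) \<in> arcs F. y \<in> T})
      \<le> card {(x, y) \<in> arcs F. x \<in> S} + card {(x, y) \<in> arcs F. y \<in> T}"
    by (rule card_Un_le)
  finally show ?thesis
    using assms by (simp add: card_arcs_from card_arcs_to flip: of_nat_sum)
qed

text \<open>Each of the sets \<open>insert u S\<close> and \<open>insert v T\<close> excludes one more vertex than is paid for
  by the bound: the arcs leaving \<open>v\<close> and those entering \<open>u\<close> are excluded twice.\<close>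

lemma card_arcs_avoiding_edge:
  assumes "finite W" "F \<subseteq> complete_graph W" "finite S" "finite T"
    and uv: "{u, v} \<in> F" and "u \<notin> S" "v \<notin> T"
    and "v \<in> S" "u \<in> T" and S: "neighbours F u \<subseteq> S" and T: "neighbours F v \<subseteq> T"
  shows "real (card (arcs F)) - (\<Sum>x\<in>S. real (deg F x)) - (\<Sum>y\<in>T. real (deg F y))
    \<le> real (card {(x, y) \<in> arcs F. x \<notin> insert u S \<and> y \<notin> insert v T})"
proof -
  let ?A = "{(x, y) \<in> arcs F. x \<in> insert u S}" and ?B = "{(x, y) \<in> arcs F. y \<in> insert v T}"
  let ?C = "{(x, y) \<in> arcs F. x \<in> {v}}" and ?D = "{(x, y) \<in> arcs F. y \<in> {u}}"
  let ?good = "{(x, y) \<in> arcs F. x \<notin> insert u S \<and> y \<notin> insert v T}"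
  have fin: "finite (arcs F)"
    using assms finite_arcs by blast
  then have finAB: "finite ?A" "finite ?B" "finite ?C" "finite ?D"
    by (rule finite_subset[rotated]; auto)+
  have "u \<noteq> v"
    using edgeD[OF assms(2) uv] by simp
  have "arcs F = ?good \<union> (?A \<union> ?B)"
    by auto
  then have *: "card (arcs F) \<le> card ?good + card (?A \<union> ?B)"
    using card_Un_le by (rule ord_eq_le_trans[OF arg_cong])
  \<comment> \<open>The overlap of \<open>?A\<close> and \<open>?B\<close> has to reach
    \<open>deg F u + deg F v\<close>, the cost of the two inserted vertices. \<open>?C\<close> and
    \<open>?D\<close> share the arc (v, u), which leaves their union one short; the arc (u, v),
    lying in neither, makes up for it.\<close>
  have "?C \<inter> ?D = {(v, u)}"
    using uv by (auto simp: arcs_def insert_commute)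
  then have CD: "card ?C + card ?D = card (?C \<union> ?D) + 1"
    using card_Un_Int[OF finAB(3,4)] by simp
  have "(u, v) \<notin> ?C \<union> ?D"
    using \<open>u \<noteq> v\<close> by auto
  then have "card (insert (u, v) (?C \<union> ?D)) = card (?C \<union> ?D) + 1"
    using finAB by simp
  moreover have "insert (u, v) (?C \<union> ?D) \<subseteq> ?A \<inter> ?B"
  proof -
    have "(x, y) \<in> ?A \<inter> ?B" if "(x, y) \<in> ?C" for x y
      using that \<open>v \<in> S\<close> T by (auto simp: arcs_def neighbours_def)
    moreover have "(x, y) \<in> ?A \<inter> ?B" if "(x, y) \<in> ?D" for x y
      using that \<open>u \<in> T\<close> S by (auto simp: arcs_def neighbours_def insert_commute)
    moreover have "(u, v) \<in> ?A \<inter> ?B"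
      using uv by (simp add: arcs_def)
    ultimately show ?thesis by auto
  qed
  ultimately have "card (?C \<union> ?D) + 1 \<le> card (?A \<inter> ?B)"
    using card_mono[of "?A \<inter> ?B" "insert (u, v) (?C \<union> ?D)"] finAB by simp
  then have "card (?A \<union> ?B) + (card ?C + card ?D) \<le> card ?A + card ?B"
    using CD card_Un_Int[OF finAB(1,2)] by linarith
  moreover have "card ?A = (\<Sum>x\<in>S. deg F x) + deg F u" "card ?B = (\<Sum>x\<in>T. deg F x) + deg F v"
    using card_arcs_from[of W F "insert u S"] card_arcs_to[of W F "insert v T"] assms by auto
  moreover have "card ?C = deg F v" "card ?D = deg F u"
    using card_arcs_from[of W F "{v}"] card_arcs_to[of W F "{u}"] assms by auto
  ultimately have "card (arcs F) \<le> card ?good + ((\<Sum>x\<in>S. deg F x) + (\<Sum>x\<in>T. deg F x))"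
    using * by linarith
  then show ?thesis
    by (simp flip: of_nat_sum)
qed

subsection \<open>Switchings\<close>

lemma deg_switch2:
  assumes "finite G"
    and "{u, v} \<in> G" "{x, y} \<in> G" "{u, x} \<notin> G" "{v, y} \<notin> G"
    and "u \<noteq> v" "x \<noteq> y" "u \<noteq> x" "v \<noteq> y"
  shows "deg (insert {u, x} (insert {v, y} (G - {{u, v}} - {{x, y}}))) w = deg G w"
proof -
  let ?F = "G - {{u, v}} - {{x, y}}"
  have ne: "{u, v} \<noteq> {x, y}" "{u, x} \<noteq> {v, y}"
    using assms by (auto simp: doubleton_eq_iff insert_commute)
  have "deg G w = deg ?F w + of_bool (w \<in> {x, y}) + of_bool (w \<in> {u, v})"
    using deg_remove[of G "{u, v}" w] deg_remove[of "G - {{u, v}}" "{x, y}" w] ne assms by auto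
  moreover have "deg (insert {v, y} ?F) w = deg ?F w + of_bool (w \<in> {v, y})"
    using assms by (intro deg_insert) auto
  moreover have "deg (insert {u, x} (insert {v, y} ?F)) w
      = deg (insert {v, y} ?F) w + of_bool (w \<in> {u, x})"
    using assms ne by (intro deg_insert) auto
  ultimately show ?thesis
    using assms by (auto simp: of_bool_def)
qed

text \<open>The removed and the inserted triple cover every vertex equally often, counted with
  multiplicity. Vertices may coincide, for instance x = y; the non-edges and inequalities keep the
  edges of each triple distinct and free of loops.\<close>

lemma deg_switch3:
  assumes "finite G"
    and "{u, v} \<notin> G" "{u, x} \<in> G" "{v, y} \<in> G" "{p, q} \<in> G" "{x, p} \<notin> G" "{y, q} \<notin> G"
    and "u \<noteq> v" "u \<noteq> x" "v \<noteq> y" "p \<noteq> q" "x \<noteq> p" "y \<noteq> q"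
  shows "deg (insert {u, v} (insert {x, p} (insert {y, q} (G - {{u, x}} - {{v, y}} - {{p, q}})))) w
    = deg G w"
proof -
  let ?F = "G - {{u, x}} - {{v, y}} - {{p, q}}"
  have ne: "{u, x} \<noteq> {v, y}" "{u, x} \<noteq> {p, q}" "{v, y} \<noteq> {p, q}"
    "{u, v} \<noteq> {x, p}" "{u, v} \<noteq> {y, q}" "{x, p} \<noteq> {y, q}"
    using assms by (auto simp: doubleton_eq_iff insert_commute)
  have "deg G w = deg ?F w + of_bool (w \<in> {p, q}) + of_bool (w \<in> {v, y}) + of_bool (w \<in> {u, x})"
    using deg_remove[of G "{u, x}" w] deg_remove[of "G - {{u, x}}" "{v, y}" w]
      deg_remove[of "G - {{u, x}} - {{v, y}}" "{p, q}" w] ne assms by auto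
  moreover have "deg (insert {y, q} ?F) w = deg ?F w + of_bool (w \<in> {y, q})"
    using assms by (intro deg_insert) auto
  moreover have "deg (insert {x, p} (insert {y, q} ?F)) w
      = deg (insert {y, q} ?F) w + of_bool (w \<in> {x, p})"
    using assms ne by (intro deg_insert) auto
  moreover have "deg (insert {u, v} (insert {x, p} (insert {y, q} ?F))) w
      = deg (insert {x, p} (insert {y, q} ?F)) w + of_bool (w \<in> {u, v})"
    using assms ne by (intro deg_insert) auto
  ultimately show ?thesis
    using assms by (auto simp: of_bool_def)
qed

text \<open>Injectivity of the three-edge switching, with edges as opaque elements so that no case
  analysis on coinciding vertices arises.\<close>

lemma undo_switch3:
  assumes "a \<in> G" "b \<in> G" "c \<in> G" "i \<notin> G" "j \<notin> G" "k \<notin> G"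
  shows "insert a (insert b (insert c
    (insert i (insert j (insert k (G - {a} - {b} - {c}))) - {i} - {j} - {k}))) = G"
proof -
  have "insert i (insert j (insert k (G - {a} - {b} - {c}))) - {i} - {j} - {k} = G - {a} - {b} - {c}"
    using assms(4-6) by auto
  then show ?thesis
    using assms(1-3) by auto
qed

lemma nested_pair_cases:
  obtains a b c i j where "s = (a, (b, c), (i, j))"
proof -
  obtain a t t' where "s = (a, t, t')"
    by (rule prod_cases3)
  moreover obtain b c where "t = (b, c)"
    by (rule prod.exhaust)
  moreover obtain i j where "t' = (i, j)"
    by (rule prod.exhaust)
  ultimately show thesis
    using that by simp
qed

section \<open>Graphs with and without one further edge uv\<close>

locale edge_switching =
  fixes W :: "'a set" and d :: "'a \<Rightarrow> int" and H L :: "'a set set" and u v :: 'a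
  assumes finite_W: "finite W"
    and H_graph: "H \<subseteq> complete_graph W" and L_graph: "L \<subseteq> complete_graph W"
    and u_in_W: "u \<in> W" and v_in_W: "v \<in> W" and u_neq_v: "u \<noteq> v"
    and uv_notin_H: "{u, v} \<notin> H" and uv_notin_L: "{u, v} \<notin> L"
begin

definition res :: "'a \<Rightarrow> int" where
  "res w = d w - int (deg H w)"

definition all_graphs :: "'a set set set" where
  "all_graphs = graphs_with_degrees W d H L"

definition with_edge :: "'a set set set" where
  "with_edge = graphs_with_degrees W d (insert {u, v} H) L"

definition without_edge :: "'a set set set" where
  "without_edge = {G \<in> all_graphs. {u, v} \<notin> G}"

text \<open>The denominator of f and g. It depends on d and H only, and equals the number of arcs of
  G - H for every admissible G.\<close>

definition arc_count :: real where
  "arc_count = 2 * num_edges W d - 2 * real (card H)"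

lemma with_edge_eq: "with_edge = {G \<in> all_graphs. {u, v} \<in> G}"
  by (auto simp: with_edge_def all_graphs_def graphs_with_degrees_def)

lemma finite_all_graphs: "finite all_graphs"
  by (rule finite_subset[of _ "Pow (complete_graph W)"])
    (auto simp: all_graphs_def graphs_with_degrees_def finite_W finite_complete_graph)

lemma card_all_graphs: "card all_graphs = card with_edge + card without_edge"
proof -
  have "all_graphs = with_edge \<union> without_edge" "with_edge \<inter> without_edge = {}"
    by (auto simp: with_edge_eq without_edge_def)
  then show ?thesis
    using finite_all_graphs by (metis card_Un_disjoint finite_Un)
qed

lemma
  assumes "G \<in> all_graphs"
  shows graph: "G \<subseteq> complete_graph W" and H_sub: "H \<subseteq> G" and disj_L: "G \<inter> L = {}"
    and deg_eq: "w \<in> W \<Longrightarrow> int (deg G w) = d w"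
    and finite_graph: "finite G"
  using assms finite_W finite_complete_graph[of W] finite_subset[of G "complete_graph W"]
  by (auto simp: all_graphs_def graphs_with_degrees_def)

lemma deg_residual:
  assumes "G \<in> all_graphs" "w \<in> W"
  shows "int (deg (G - H) w) = res w"
  using deg_diff[of G H w] finite_graph H_sub deg_eq assms by (simp add: res_def)

lemma real_deg_residual:
  "G \<in> all_graphs \<Longrightarrow> w \<in> W \<Longrightarrow> real (deg (G - H) w) = real_of_int (res w)"
  by (metis deg_residual of_int_of_nat_eq)

lemma res_nonneg: "G \<in> all_graphs \<Longrightarrow> w \<in> W \<Longrightarrow> 0 \<le> res w"
  by (metis deg_residual of_nat_0_le_iff)

lemma residual_graph: "G \<in> all_graphs \<Longrightarrow> G - H \<subseteq> complete_graph W"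
  using graph by blast

lemma arc_count:
  assumes "G \<in> all_graphs"
  shows "real (card (arcs (G - H))) = arc_count"
proof -
  have "real (card (arcs (G - H))) = real_of_int (\<Sum>w\<in>W. int (deg (G - H) w))"
    using card_arcs_sum_deg[OF finite_W residual_graph[OF assms]] by simp
  also have "\<dots> = real_of_int (\<Sum>w\<in>W. res w)"
    using deg_residual[OF assms] by simp
  also have "\<dots> = (\<Sum>w\<in>W. real_of_int (d w)) - real (\<Sum>w\<in>W. deg H w)"
    by (simp add: res_def sum_subtractf)
  finally show ?thesis
    using sum_deg[OF finite_W H_graph] by (simp add: arc_count_def num_edges_def)
qed

lemma card_neighbours_residual:
  "G \<in> all_graphs \<Longrightarrow> w \<in> W \<Longrightarrow> real (card (neighbours (G - H) w)) = real_of_int (res w)"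
  by (simp add: card_neighbours[OF residual_graph] real_deg_residual)

text \<open>The vertices to which x cannot receive a new edge. All of G counts here, not just G - H,
  whence the size bound d_x + l_x with the full degree.\<close>

definition blocked :: "'a set set \<Rightarrow> 'a \<Rightarrow> 'a set" where
  "blocked G x = neighbours G x \<union> neighbours L x"

lemma blocked_subset: "G \<in> all_graphs \<Longrightarrow> blocked G x \<subseteq> W - {x}"
  using neighbours_subset[OF graph, of G x] neighbours_subset[OF L_graph, of x]
  by (simp add: blocked_def)

lemma finite_blocked: "G \<in> all_graphs \<Longrightarrow> finite (blocked G x)"
  by (rule finite_subset[OF blocked_subset]) (simp_all add: finite_W)

lemma notin_blocked: "y \<notin> blocked G x \<longleftrightarrow> {x, y} \<notin> G \<and> {x, y} \<notin> L"
  by (auto simp: blocked_def neighbours_def)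

lemma card_blocked:
  assumes "G \<in> all_graphs" "x \<in> W"
  shows "int (card (blocked G x)) \<le> d x + int (deg L x)"
  using card_Un_le[of "neighbours G x" "neighbours L x"] deg_eq[OF assms]
    card_neighbours[OF graph[OF assms(1)]] card_neighbours[OF L_graph]
  by (simp add: blocked_def)

lemma W_nonempty: "W \<noteq> {}"
  using u_in_W by auto

text \<open>The left-hand side counts the arcs of G - H that start in a blocked vertex; this is the
  source of the terms D_H(d_u + l_u) in f.\<close>

lemma sum_blocked_le:
  assumes "G \<in> all_graphs" "x \<in> W"
  shows "(\<Sum>p\<in>blocked G x. real (deg (G - H) p))
    \<le> deg_sum_residual W d H (real_of_int (d x + int (deg L x)))"
proof -
  have sub: "blocked G x \<subseteq> W"
    using blocked_subset[OF assms(1), of x] by blast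
  have "(\<Sum>p\<in>blocked G x. real (deg (G - H) p)) = (\<Sum>p\<in>blocked G x. real_of_int (res p))"
    using real_deg_residual[OF assms(1)] sub by (intro sum.cong) auto
  also have "\<dots> \<le> deg_sum W res (real_of_int (d x + int (deg L x)))"
    using card_blocked[OF assms] res_nonneg[OF assms(1)] sub
    by (intro sum_le_deg_sum finite_W W_nonempty) auto
  finally show ?thesis
    by (simp add: deg_sum_residual_def res_def[abs_def])
qed

text \<open>Summing over the residual neighbours \<open>x\<close> of \<open>z\<close>, Jensen's inequality replaces the numbers
  \<open>d\<^sub>x + l\<^sub>x\<close> by the bound \<open>\<alpha>\<^sub>z\<close> on their average.\<close>

lemma sum_sum_blocked_le:
  assumes "G \<in> all_graphs" "z \<in> W"
  defines "\<alpha> \<equiv> alpha_value W d (\<lambda>v. int (deg L v)) d (\<lambda>v. int (deg H v)) z"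
  shows "(\<Sum>x\<in>neighbours (G - H) z. \<Sum>p\<in>insert x (blocked G x). real (deg (G - H) p))
    \<le> real_of_int (res z) * deg_sum_residual W d H (\<alpha> + 2)" and "0 \<le> \<alpha>"
proof -
  let ?N = "neighbours (G - H) z"
  have N: "?N \<subseteq> W"
    using neighbours_subset[OF residual_graph[OF assms(1)]] by blast
  have dl: "0 \<le> d w + int (deg L w)" if "w \<in> W" for w
    using deg_eq[OF assms(1) that] by simp
  show "0 \<le> \<alpha>"
    unfolding \<alpha>_def alpha_value_def
    by (intro divide_nonneg_pos deg_sum_nonneg finite_W W_nonempty dl) auto
  have card_N: "real (card ?N) = real_of_int (res z)"
    using card_neighbours_residual[OF assms(1,2)] .
  have sub: "insert x (blocked G x) \<subseteq> W" if "x \<in> ?N" for x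
    using blocked_subset[OF assms(1)] N that by blast
  \<comment> \<open>For nonempty \<open>?N\<close> the maximum with 1 in alpha is just
    \<open>card ?N\<close>, so alpha times \<open>card ?N\<close> is the value of D that bounds any
    sum of \<open>card ?N\<close> entries of d + l.\<close>
  have "(\<Sum>x\<in>?N. real_of_int (d x + int (deg L x))) \<le> real (card ?N) * \<alpha>"
  proof (cases "?N = {}")
    case False
    then have "0 < card ?N"
      using finite_subset[OF N finite_W] by (simp add: card_gt_0_iff)
    then have "max (d z - int (deg H z)) 1 = int (card ?N)"
      using card_N by (simp add: res_def)
    then have "\<alpha> = deg_sum W (\<lambda>v. d v + int (deg L v)) (real (card ?N)) / real (card ?N)"
      by (simp add: \<alpha>_def alpha_value_def)
    with \<open>0 < card ?N\<close> show ?thesis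
      using sum_le_deg_sum[OF finite_W W_nonempty dl N order_refl] by simp
  qed simp
  \<comment> \<open>The vertex x adds one to the at most d_x + l_x blocked vertices, which the + 2
    in g covers.\<close>
  moreover have "real (card (insert x (blocked G x))) \<le> real_of_int (d x + int (deg L x)) + 2"
    if "x \<in> ?N" for x
    using card_blocked[OF assms(1), of x] N that finite_blocked[OF assms(1), of x]
    by (auto simp: card_insert_if subset_iff)
  then have "(\<Sum>x\<in>?N. real (card (insert x (blocked G x))))
      \<le> (\<Sum>x\<in>?N. real_of_int (d x + int (deg L x)) + 2)"
    by (rule sum_mono)
  ultimately have avg: "(\<Sum>x\<in>?N. real (card (insert x (blocked G x)))) \<le> real (card ?N) * (\<alpha> + 2)"
    by (simp add: sum.distrib algebra_simps)
  have "(\<Sum>x\<in>?N. \<Sum>p\<in>insert x (blocked G x). real (deg (G - H) p))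
      = (\<Sum>x\<in>?N. \<Sum>p\<in>insert x (blocked G x). real_of_int (res p))"
    using real_deg_residual[OF assms(1)] sub by (intro sum.cong refl) blast
  also have "\<dots> \<le> real (card ?N) * deg_sum W res (\<alpha> + 2)"
    using res_nonneg[OF assms(1)] sub avg \<open>0 \<le> \<alpha>\<close>
    by (intro sum_sum_le_deg_sum finite_W W_nonempty) auto
  finally show "(\<Sum>x\<in>?N. \<Sum>p\<in>insert x (blocked G x). real (deg (G - H) p))
      \<le> real_of_int (res z) * deg_sum_residual W d H (\<alpha> + 2)"
    by (simp add: card_N deg_sum_residual_def res_def[abs_def])
qed

text \<open>The arcs (p, q) of G - H for which both xp and yq may be inserted; \<open>insert\<close>
  excludes the loops. The two-edge switching uses it with x = u and y = v.\<close>

definition good_arcs :: "'a set set \<Rightarrow> 'a \<Rightarrow> 'a \<Rightarrow> ('a \<times> 'a) set" where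
  "good_arcs G x y = {(p, q) \<in> arcs (G - H). p \<notin> insert x (blocked G x) \<and> q \<notin> insert y (blocked G y)}"

lemma finite_good_arcs: "G \<in> all_graphs \<Longrightarrow> finite (good_arcs G x y)"
  unfolding good_arcs_def using finite_arcs[OF finite_W residual_graph]
  by (rule finite_subset[rotated]) auto

text \<open>The switching replaces the edges \<open>uv, xy\<close> by \<open>ux, vy\<close>.\<close>

lemma switching_upper:
  "real (card with_edge) * (arc_count
      - deg_sum_residual W d H (real_of_int (d u + int (deg L u)))
      - deg_sum_residual W d H (real_of_int (d v + int (deg L v))))
    \<le> real (card without_edge) * (real_of_int (res u) * real_of_int (res v))"
proof -
  let ?D = "deg_sum_residual W d H"
  \<comment> \<open>The chosen x and y stay part of the triple, so the switching can be undone. In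
    the image, ux and vy are edges outside H, because before the switching they were not even in
    G.\<close>
  define P where "P = Sigma with_edge (\<lambda>G. good_arcs G u v)"
  define Q where "Q = Sigma without_edge
    (\<lambda>G. neighbours (G - H) u \<times> neighbours (G - H) v)"
  define \<phi> where "\<phi> = (\<lambda>(G, x, y).
    (insert {u, x} (insert {v, y} (G - {{u, v}} - {{x, y}})), x, y))"
  have fin: "finite with_edge" "finite without_edge"
    using finite_all_graphs by (auto simp: with_edge_eq without_edge_def)
  have "real (card with_edge) * (arc_count - ?D (real_of_int (d u + int (deg L u)))
      - ?D (real_of_int (d v + int (deg L v))))
    \<le> (\<Sum>G\<in>with_edge. real (card (good_arcs G u v)))"
  proof (rule sum_bounded_below)
    fix G assume "G \<in> with_edge"
    then have G: "G \<in> all_graphs" "{u, v} \<in> G"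
      by (auto simp: with_edge_eq)
    \<comment> \<open>Since uv is an edge of G, v is blocked for u and u for v. This makes the
      sharper count available, so excluding the vertices u and v themselves adds nothing to the
      arguments of D in f.\<close>
    have "real (card (arcs (G - H))) - (\<Sum>x\<in>blocked G u. real (deg (G - H) x))
      - (\<Sum>y\<in>blocked G v. real (deg (G - H) y)) \<le> real (card (good_arcs G u v))"
      unfolding good_arcs_def
    proof (rule card_arcs_avoiding_edge[OF finite_W residual_graph[OF G(1)]])
      show "{u, v} \<in> G - H"
        using G uv_notin_H by simp
      show "u \<notin> blocked G u" "v \<notin> blocked G v"
        using blocked_subset[OF G(1), of u] blocked_subset[OF G(1), of v] by blast+
      show "finite (blocked G u)" "finite (blocked G v)"
        using finite_blocked[OF G(1)] by blast+
    qed (use G in \<open>auto simp: blocked_def neighbours_def insert_commute\<close>)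
    then show "arc_count - ?D (real_of_int (d u + int (deg L u)))
        - ?D (real_of_int (d v + int (deg L v))) \<le> real (card (good_arcs G u v))"
      using sum_blocked_le[OF G(1) u_in_W] sum_blocked_le[OF G(1) v_in_W] arc_count[OF G(1)]
      by linarith
  qed
  also have "\<dots> = real (card P)"
    using fin finite_good_arcs by (simp add: P_def with_edge_eq)
  also have "\<dots> \<le> real (card Q)"
  proof -
    have "inj_on \<phi> P"
    proof (rule inj_on_inverseI[where
          g = "\<lambda>(G, x, y). (insert {u, v} (insert {x, y} (G - {{u, x}} - {{v, y}})), x, y)"])
      fix s assume "s \<in> P"
      then obtain G x y where s: "s = (G, x, y)" "{u, v} \<in> G" "{x, y} \<in> G"
          "{u, x} \<notin> G" "{v, y} \<notin> G"
        by (auto simp: P_def good_arcs_def with_edge_eq arcs_def notin_blocked)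
      then show "(\<lambda>(G, x, y). (insert {u, v} (insert {x, y} (G - {{u, x}} - {{v, y}})), x, y))
          (\<phi> s) = s"
        by (auto simp: \<phi>_def)
    qed
    moreover have "\<phi> ` P \<subseteq> Q"
    proof
      fix s assume "s \<in> \<phi> ` P"
      then obtain G x y where s: "s = \<phi> (G, x, y)" and G: "G \<in> all_graphs" "{u, v} \<in> G"
          and xy: "{x, y} \<in> G" "{x, y} \<notin> H" "{u, x} \<notin> G" "{v, y} \<notin> G"
            "{u, x} \<notin> L" "{v, y} \<notin> L" "u \<noteq> x" "v \<noteq> y"
        by (auto simp: P_def good_arcs_def with_edge_eq arcs_def notin_blocked)
      let ?G = "insert {u, x} (insert {v, y} (G - {{u, v}} - {{x, y}}))"
      have W: "x \<in> W" "y \<in> W" "x \<noteq> y"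
        using edgeD[OF graph[OF G(1)] xy(1)] by auto
      have "deg ?G w = deg G w" for w
        using G xy W u_neq_v finite_graph[OF G(1)] by (intro deg_switch2) auto
      then have "?G \<in> all_graphs"
        using G xy W graph[OF G(1)] H_sub[OF G(1)] disj_L[OF G(1)] deg_eq[OF G(1)]
          u_in_W v_in_W uv_notin_H
        by (auto simp: all_graphs_def graphs_with_degrees_def edge_in_complete_graph)
      moreover have "{u, v} \<notin> ?G"
        using xy G by (auto simp: doubleton_eq_iff insert_commute)
      moreover have "{u, x} \<notin> H" "{v, y} \<notin> H"
        using xy H_sub[OF G(1)] by auto
      ultimately show "s \<in> Q"
        by (simp add: s \<phi>_def Q_def without_edge_def neighbours_def)
    qed
    moreover have "finite Q"
      unfolding Q_def using fin
      by (intro finite_SigmaI finite_neighbours[OF finite_W residual_graph])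
        (auto simp: without_edge_def)
    ultimately show ?thesis
      by (simp add: card_inj_on_le)
  qed
  also have "real (card Q) = (\<Sum>G\<in>without_edge. real_of_int (res u) * real_of_int (res v))"
  proof -
    have "real (card (neighbours (G - H) w)) = real_of_int (res w)"
      if "G \<in> without_edge" "w \<in> W" for G w
      using card_neighbours_residual[of G w] that
      by (simp add: without_edge_def)
    then show ?thesis
      unfolding Q_def using fin u_in_W v_in_W
      by (subst card_SigmaI)
        (auto simp: card_cartesian_product without_edge_def
          intro!: finite_neighbours[OF finite_W residual_graph])
  qed
  finally show ?thesis
    by simp
qed

text \<open>The switching replaces the edges \<open>ux, vy, pq\<close> by \<open>uv, xp, yq\<close>.\<close>

lemma switching_lower:
  defines "\<alpha> \<equiv> alpha_value W d (\<lambda>v. int (deg L v)) d (\<lambda>v. int (deg H v))"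
  shows "real (card without_edge) * (real_of_int (res u) * real_of_int (res v) * (arc_count
      - deg_sum_residual W d H (\<alpha> u + 2) - deg_sum_residual W d H (\<alpha> v + 2)))
    \<le> real (card with_edge) * arc_count\<^sup>2"
proof -
  let ?D = "deg_sum_residual W d H"
  define conf where "conf = (\<lambda>G. Sigma (neighbours (G - H) u \<times> neighbours (G - H) v)
    (\<lambda>(x, y). good_arcs G x y))"
  define P where "P = Sigma without_edge conf"
  define Q where "Q = Sigma with_edge (\<lambda>G. arcs (G - H) \<times> arcs (G - H))"
  define \<phi> where "\<phi> = (\<lambda>(G, (x, y), (p, q)).
    (insert {u, v} (insert {x, p} (insert {y, q} (G - {{u, x}} - {{v, y}} - {{p, q}}))),
      (x, p), (y, q)))"
  define \<psi> where "\<psi> = (\<lambda>(G, (x, p), (y, q)).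
    (insert {u, x} (insert {v, y} (insert {p, q} (G - {{u, v}} - {{x, p}} - {{y, q}}))),
      (x, y), (p, q)))"
  have fin: "finite with_edge" "finite without_edge"
    using finite_all_graphs by (auto simp: with_edge_eq without_edge_def)
  have fin_nb: "finite (neighbours (G - H) x)" if "G \<in> all_graphs" for G x
    using finite_neighbours[OF finite_W residual_graph[OF that]] .
  have "real (card without_edge) * (real_of_int (res u) * real_of_int (res v) *
      (arc_count - ?D (\<alpha> u + 2) - ?D (\<alpha> v + 2)))
    \<le> (\<Sum>G\<in>without_edge. real (card (conf G)))"
  proof (rule sum_bounded_below)
    fix G assume "G \<in> without_edge"
    then have G: "G \<in> all_graphs"
      by (auto simp: without_edge_def)
    let ?A = "neighbours (G - H) u" and ?B = "neighbours (G - H) v"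
    define s where "s x = (\<Sum>p\<in>insert x (blocked G x). real (deg (G - H) p))" for x
    have card: "real (card ?A) = real_of_int (res u)" "real (card ?B) = real_of_int (res v)"
      using card_neighbours_residual[OF G] u_in_W v_in_W by blast+
    have good: "arc_count - s x - s y \<le> real (card (good_arcs G x y))" for x y
      using card_arcs_avoiding[OF finite_W residual_graph[OF G],
          of "insert x (blocked G x)" "insert y (blocked G y)"]
        finite_blocked[OF G]
      by (simp only: good_arcs_def s_def finite_insert simp_thms arc_count[OF G])
    \<comment> \<open>The losses at x and y separate: each \<open>s x\<close> occurs once per choice
      of y, that is, \<open>res v\<close> times. Only the sums of \<open>s\<close> over the two
      neighbourhoods remain, to which the averaged bound applies.\<close>
    have "(\<Sum>x\<in>?A. \<Sum>y\<in>?B. arc_count - s x - s y)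
        = real_of_int (res u) * real_of_int (res v) * arc_count
          - real_of_int (res v) * (\<Sum>x\<in>?A. s x) - real_of_int (res u) * (\<Sum>y\<in>?B. s y)"
      by (simp add: sum_subtractf card flip: sum_distrib_left) (simp add: algebra_simps)
    moreover have "real_of_int (res v) * (\<Sum>x\<in>?A. s x)
        \<le> real_of_int (res v) * (real_of_int (res u) * ?D (\<alpha> u + 2))"
      unfolding s_def \<alpha>_def
      using sum_sum_blocked_le(1)[OF G u_in_W] res_nonneg[OF G v_in_W]
      by (intro mult_left_mono) auto
    moreover have "real_of_int (res u) * (\<Sum>x\<in>?B. s x)
        \<le> real_of_int (res u) * (real_of_int (res v) * ?D (\<alpha> v + 2))"
      unfolding s_def \<alpha>_def
      using sum_sum_blocked_le(1)[OF G v_in_W] res_nonneg[OF G u_in_W]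
      by (intro mult_left_mono) auto
    ultimately have "real_of_int (res u) * real_of_int (res v) *
        (arc_count - ?D (\<alpha> u + 2) - ?D (\<alpha> v + 2)) \<le> (\<Sum>x\<in>?A. \<Sum>y\<in>?B. arc_count - s x - s y)"
      by (simp add: algebra_simps)
    also have "\<dots> \<le> (\<Sum>x\<in>?A. \<Sum>y\<in>?B. real (card (good_arcs G x y)))"
      by (intro sum_mono good)
    also have "\<dots> = real (card (conf G))"
      unfolding conf_def using fin_nb[OF G] finite_good_arcs[OF G]
      by (subst card_SigmaI) (auto simp: sum.cartesian_product case_prod_beta)
    finally show "real_of_int (res u) * real_of_int (res v) *
        (arc_count - ?D (\<alpha> u + 2) - ?D (\<alpha> v + 2)) \<le> real (card (conf G))" .
  qed
  also have "\<dots> = real (card P)"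
    unfolding P_def using fin fin_nb finite_good_arcs
    by (subst card_SigmaI) (auto simp: conf_def without_edge_def)
  also have "\<dots> \<le> real (card Q)"
  proof -
    have P: "G \<in> all_graphs \<and> {u, v} \<notin> G \<and> {u, x} \<in> G \<and> {u, x} \<notin> H \<and> {v, y} \<in> G
        \<and> {v, y} \<notin> H \<and> {p, q} \<in> G \<and> {p, q} \<notin> H \<and> {x, p} \<notin> G \<and> {x, p} \<notin> L
        \<and> {y, q} \<notin> G \<and> {y, q} \<notin> L \<and> x \<noteq> p \<and> y \<noteq> q"
      if "(G, (x, y), (p, q)) \<in> P" for G x y p q
      using that
      by (auto simp: P_def conf_def good_arcs_def without_edge_def arcs_def neighbours_def
          notin_blocked)
    have "inj_on \<phi> P"
    proof (rule inj_on_inverseI[where g = \<psi>])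
      fix s assume "s \<in> P"
      moreover obtain G x y p q where s: "s = (G, (x, y), (p, q))"
        by (rule nested_pair_cases)
      ultimately have *: "(G, (x, y), (p, q)) \<in> P"
        by simp
      have "insert {u, x} (insert {v, y} (insert {p, q}
          (insert {u, v} (insert {x, p} (insert {y, q} (G - {{u, x}} - {{v, y}} - {{p, q}})))
            - {{u, v}} - {{x, p}} - {{y, q}}))) = G"
        using P[OF *] by (intro undo_switch3) simp_all
      then show "\<psi> (\<phi> s) = s"
        by (simp add: \<phi>_def \<psi>_def s)
    qed
    moreover have "\<phi> ` P \<subseteq> Q"
    proof
      fix s assume "s \<in> \<phi> ` P"
      then obtain t where t: "s = \<phi> t" "t \<in> P"
        by blast
      obtain G x y p q where "t = (G, (x, y), (p, q))"
        by (rule nested_pair_cases)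
      with t have s: "s = \<phi> (G, (x, y), (p, q))" and *: "(G, (x, y), (p, q)) \<in> P"
        by simp_all
      have G: "G \<in> all_graphs" "{u, v} \<notin> G"
        and E: "{u, x} \<in> G" "{u, x} \<notin> H" "{v, y} \<in> G" "{v, y} \<notin> H" "{p, q} \<in> G" "{p, q} \<notin> H"
          "{x, p} \<notin> G" "{x, p} \<notin> L" "{y, q} \<notin> G" "{y, q} \<notin> L" "x \<noteq> p" "y \<noteq> q"
        using P[OF *] by simp_all
      let ?G = "insert {u, v} (insert {x, p} (insert {y, q} (G - {{u, x}} - {{v, y}} - {{p, q}})))"
      have W: "x \<in> W" "y \<in> W" "p \<in> W" "q \<in> W" "p \<noteq> q" "u \<noteq> x" "v \<noteq> y"
        using edgeD[OF graph[OF G(1)]] E by blast+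
      have "deg ?G w = deg G w" for w
        using G E W u_neq_v finite_graph[OF G(1)] by (intro deg_switch3) auto
      moreover have "?G \<subseteq> complete_graph W"
        using graph[OF G(1)] W E(11,12) u_in_W v_in_W u_neq_v
        by (auto simp: edge_in_complete_graph)
      moreover have "insert {u, v} H \<subseteq> ?G"
        using H_sub[OF G(1)] E by blast
      moreover have "?G \<inter> L = {}"
        using disj_L[OF G(1)] E uv_notin_L by blast
      ultimately have "?G \<in> with_edge"
        using deg_eq[OF G(1)] by (simp add: with_edge_def graphs_with_degrees_def)
      moreover have "{x, p} \<notin> H" "{y, q} \<notin> H"
        using E H_sub[OF G(1)] by blast+
      ultimately show "s \<in> Q"
        by (simp add: s \<phi>_def Q_def arcs_def)
    qed
    moreover have "finite Q"
      unfolding Q_def using fin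
      by (intro finite_SigmaI finite_cartesian_product finite_arcs[OF finite_W residual_graph])
        (auto simp: with_edge_eq)
    ultimately show ?thesis
      by (simp add: card_inj_on_le)
  qed
  also have "real (card Q) = (\<Sum>G\<in>with_edge. arc_count\<^sup>2)"
  proof -
    have "card Q = (\<Sum>G\<in>with_edge. card (arcs (G - H)) * card (arcs (G - H)))"
      unfolding Q_def using fin
      by (subst card_SigmaI)
        (auto simp: card_cartesian_product with_edge_eq
          intro!: finite_arcs[OF finite_W residual_graph])
    then show ?thesis
      using arc_count by (simp add: with_edge_eq power2_eq_square)
  qed
  finally show ?thesis
    by simp
qed

text \<open>Some edge is left in G - H, and its two ends have residual degree at least 1. This
  yields g \<le> 1, and a negative g when only one edge is left.\<close>

lemma two_le_deg_sum_residual: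
  assumes "G \<in> all_graphs" "0 < arc_count" "2 \<le> x"
  shows "2 \<le> deg_sum_residual W d H x"
proof -
  have "arcs (G - H) \<noteq> {}"
    using arc_count[OF assms(1)] assms(2) by auto
  then obtain p q where pq: "{p, q} \<in> G - H"
    by (auto simp: arcs_def)
  then have W: "p \<in> W" "q \<in> W" "p \<noteq> q"
    using edgeD[OF residual_graph[OF assms(1)]] by auto
  have "{q, p} \<in> G - H"
    using pq by (simp add: insert_commute)
  with pq have "q \<in> neighbours (G - H) p" "p \<in> neighbours (G - H) q"
    by (simp_all add: neighbours_def)
  then have "0 < card (neighbours (G - H) p)" "0 < card (neighbours (G - H) q)"
    using finite_neighbours[OF finite_W residual_graph[OF assms(1)]]
    by (auto simp: card_gt_0_iff)
  then have "1 \<le> res p" "1 \<le> res q"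
    using card_neighbours_residual[OF assms(1) W(1)] card_neighbours_residual[OF assms(1) W(2)]
    by linarith+
  moreover have "(\<Sum>w\<in>{p, q}. real_of_int (res w)) \<le> deg_sum W res x"
    using W assms(3) res_nonneg[OF assms(1)]
    by (intro sum_le_deg_sum finite_W W_nonempty) auto
  ultimately show ?thesis
    using W by (simp add: deg_sum_residual_def res_def[abs_def])
qed

end

subsection \<open>Successive edges\<close>

lemma num_edges_eq:
  assumes "finite W" "G \<in> graphs_with_degrees W d X L"
  shows "num_edges W d = real (card G)"
proof -
  have G: "G \<subseteq> complete_graph W" "\<And>w. w \<in> W \<Longrightarrow> d w = int (deg G w)"
    using assms(2) by (auto simp: graphs_with_degrees_def)
  then have "(\<Sum>w\<in>W. real_of_int (d w)) = real (\<Sum>w\<in>W. deg G w)"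
    by simp
  then show ?thesis
    using sum_deg[OF assms(1) G(1)] by (simp add: num_edges_def)
qed

lemma finite_graphs_with_degrees: "finite W \<Longrightarrow> finite (graphs_with_degrees W d X L)"
  by (rule finite_subset[of _ "Pow (complete_graph W)"])
    (auto simp: graphs_with_degrees_def finite_complete_graph)

lemma falling_fact_Suc: "falling_fact x (Suc n) = falling_fact x n * (x - real n)"
  by (simp add: falling_fact_def)

text \<open>Negative factors occur only together with the factor 0 at j = n.\<close>

lemma falling_fact_nonneg: "0 \<le> falling_fact (real n) k"
proof (cases "n < k")
  case True
  then have "falling_fact (real n) k = 0"
    by (auto simp: falling_fact_def)
  then show ?thesis by simp
next
  case False
  then show ?thesis
    by (auto simp: falling_fact_def intro!: prod_nonneg)
qed

lemma falling_fact_eq_0_iff: "falling_fact (real n) k = 0 \<longleftrightarrow> n < k"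
  by (auto simp: falling_fact_def)

section \<open>The main term and its change under adding one edge\<close>

definition deg_ratio :: "'a set \<Rightarrow> ('a \<Rightarrow> int) \<Rightarrow> 'a set set \<Rightarrow> real" where
  "deg_ratio W d H = (\<Prod>w\<in>W. falling_fact (real_of_int (d w)) (deg H w))
    / (2 ^ card H * falling_fact (num_edges W d) (card H))"

definition edge_ratio :: "'a set \<Rightarrow> ('a \<Rightarrow> int) \<Rightarrow> 'a set set \<Rightarrow> 'a set \<Rightarrow> real" where
  "edge_ratio W d H E = (\<Prod>w\<in>E. real_of_int (d w - int (deg H w)))
    / (2 * num_edges W d - 2 * real (card H))"

lemma deg_ratio_empty: "deg_ratio W d {} = 1"
  by (simp add: deg_ratio_def falling_fact_def deg_def)

text \<open>Each end w of \<open>E\<close> gains the factor d_w - h_w of its falling factorial, and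
  the denominator gains 2 (m(G) - m(H)).\<close>

lemma deg_ratio_insert:
  assumes "finite W" "finite H" "E \<notin> H" "E \<subseteq> W"
  shows "deg_ratio W d (insert E H) = deg_ratio W d H * edge_ratio W d H E"
proof -
  have "(\<Prod>w\<in>W. falling_fact (real_of_int (d w)) (deg (insert E H) w))
      = (\<Prod>w\<in>W. falling_fact (real_of_int (d w)) (deg H w)
          * (if w \<in> E then real_of_int (d w - int (deg H w)) else 1))"
    using assms by (intro prod.cong) (auto simp: deg_insert falling_fact_Suc)
  also have "\<dots> = (\<Prod>w\<in>W. falling_fact (real_of_int (d w)) (deg H w))
      * (\<Prod>w\<in>E. real_of_int (d w - int (deg H w)))"
    using assms by (simp add: prod.distrib prod.If_cases inf.absorb2)
  finally show ?thesis
    using assms(2,3)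
    by (simp add: deg_ratio_def edge_ratio_def falling_fact_Suc algebra_simps)
qed

text \<open>The first switching bounds |P| f by q |N|, and |N| is at most the number of all graphs.
  A graph containing \<open>E\<close> makes the denominator of q positive and the residual degrees
  nonnegative, which also gives the second claim.\<close>

lemma
  assumes "finite W" "H \<subseteq> complete_graph W" "L \<subseteq> complete_graph W"
    and "E \<in> complete_graph W" "E \<notin> H" "E \<notin> L"
    and ne: "graphs_with_degrees W d (insert E H) L \<noteq> {}"
    and f: "0 < f_val W d H L E"
  shows card_insert_le: "real (card (graphs_with_degrees W d (insert E H) L))
      \<le> real (card (graphs_with_degrees W d H L)) * (edge_ratio W d H E * (1 / f_val W d H L E))"
    and edge_ratio_nonneg: "0 \<le> edge_ratio W d H E"
proof -
  obtain u v where E: "E = {u, v}" "u \<in> W" "v \<in> W" "u \<noteq> v"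
    using assms(4) by (rule complete_graphE)
  interpret edge_switching W d H L u v
    using assms E by unfold_locales auto
  obtain G where "G \<in> with_edge"
    using ne by (auto simp: with_edge_def E)
  then have G: "G \<in> all_graphs" "{u, v} \<in> G"
    by (auto simp: with_edge_eq)
  have "(u, v) \<in> arcs (G - H)"
    using G uv_notin_H by (simp add: arcs_def)
  then have pos: "0 < arc_count"
    using finite_arcs[OF finite_W residual_graph[OF G(1)]]
    by (auto simp: card_gt_0_iff simp flip: arc_count[OF G(1)])
  have ratio: "edge_ratio W d H E = real_of_int (res u) * real_of_int (res v) / arc_count"
    using E by (simp add: edge_ratio_def arc_count_def res_def)
  show "0 \<le> edge_ratio W d H E"
    using res_nonneg[OF G(1)] u_in_W v_in_W pos by (simp add: ratio)
  have f_eq: "arc_count * f_val W d H L E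
      = arc_count - deg_sum_residual W d H (real_of_int (d u + int (deg L u)))
        - deg_sum_residual W d H (real_of_int (d v + int (deg L v)))"
  proof -
    have "f_val W d H L E = 1 - (deg_sum_residual W d H (real_of_int (d u + int (deg L u)))
        + deg_sum_residual W d H (real_of_int (d v + int (deg L v)))) / arc_count"
      using E by (simp add: f_val_def arc_count_def)
    then show ?thesis
      using pos by (simp add: field_simps)
  qed
  have "real (card with_edge) * (arc_count * f_val W d H L E)
      \<le> real (card without_edge) * (real_of_int (res u) * real_of_int (res v))"
    unfolding f_eq by (rule switching_upper)
  also have "\<dots> \<le> real (card all_graphs) * (real_of_int (res u) * real_of_int (res v))"
    using res_nonneg[OF G(1)] u_in_W v_in_W card_all_graphs by (intro mult_right_mono) auto
  finally show "real (card (graphs_with_degrees W d (insert E H) L))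
      \<le> real (card (graphs_with_degrees W d H L)) * (edge_ratio W d H E * (1 / f_val W d H L E))"
    using pos f unfolding ratio with_edge_def[symmetric, folded E(1)] all_graphs_def[symmetric]
    by (simp add: field_simps)
qed

text \<open>The second switching gives |N| q g \<le> |P|. Adding |P| q g \<le> |P| q, which rests on
  g \<le> 1, turns this into (|P| + |N|) q g \<le> |P| (1 + q).\<close>

lemma card_insert_ge:
  assumes "finite W" "H \<subseteq> complete_graph W" "L \<subseteq> complete_graph W"
    and "E \<in> complete_graph W" "E \<notin> H" "E \<notin> L"
    and pos: "real (card H) < num_edges W d"
    and nonneg: "0 \<le> edge_ratio W d H E"
  shows "real (card (graphs_with_degrees W d H L))
      * (edge_ratio W d H E * g_val W d H L E / (1 + edge_ratio W d H E))
    \<le> real (card (graphs_with_degrees W d (insert E H) L))"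
proof (cases "graphs_with_degrees W d H L = {}")
  case False
  obtain u v where E: "E = {u, v}" "u \<in> W" "v \<in> W" "u \<noteq> v"
    using assms(4) by (rule complete_graphE)
  interpret edge_switching W d H L u v
    using assms E by unfold_locales auto
  let ?q = "edge_ratio W d H E" and ?g = "g_val W d H L E"
  obtain G where G: "G \<in> all_graphs"
    using False by (auto simp: all_graphs_def)
  define \<alpha> where "\<alpha> = alpha_value W d (\<lambda>v. int (deg L v)) d (\<lambda>v. int (deg H v))"
  let ?D = "deg_sum_residual W d H"
  have arcs_pos: "0 < arc_count"
    using pos by (simp add: arc_count_def)
  have ratio: "?q = real_of_int (res u) * real_of_int (res v) / arc_count"
    using E by (simp add: edge_ratio_def arc_count_def res_def)
  have g_eq: "arc_count * ?g = arc_count - ?D (\<alpha> u + 2) - ?D (\<alpha> v + 2)"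
  proof -
    have "?g = 1 - (?D (\<alpha> u + 2) + ?D (\<alpha> v + 2)) / arc_count"
      using E by (simp add: g_val_def \<alpha>_def arc_count_def)
    then show ?thesis
      using arcs_pos by (simp add: field_simps)
  qed
  have "2 \<le> \<alpha> u + 2" "2 \<le> \<alpha> v + 2"
    using sum_sum_blocked_le(2)[OF G] u_in_W v_in_W by (simp_all add: \<alpha>_def)
  then have "2 \<le> ?D (\<alpha> u + 2)" "2 \<le> ?D (\<alpha> v + 2)"
    using two_le_deg_sum_residual[OF G arcs_pos] by blast+
  then have "arc_count * ?g \<le> arc_count * 1"
    unfolding g_eq by simp
  then have "?g \<le> 1"
    by (rule mult_left_le_imp_le) (rule arcs_pos)
  have "real (card without_edge) * (real_of_int (res u) * real_of_int (res v) * (arc_count * ?g))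
      \<le> real (card with_edge) * arc_count\<^sup>2"
    unfolding g_eq \<alpha>_def by (rule switching_lower)
  then have "real (card without_edge) * (?q * ?g) \<le> real (card with_edge)"
    using arcs_pos by (simp add: ratio power2_eq_square field_simps)
  moreover have "real (card with_edge) * (?q * ?g) \<le> real (card with_edge) * ?q"
    using \<open>?g \<le> 1\<close> nonneg by (intro mult_left_mono mult_left_le) auto
  ultimately have "real (card all_graphs) * (?q * ?g) \<le> real (card with_edge) * (1 + ?q)"
    by (simp add: card_all_graphs algebra_simps)
  then show ?thesis
    using nonneg unfolding E(1) with_edge_def[symmetric] all_graphs_def[symmetric]
    by (simp add: field_simps)
qed simp

text \<open>When a single edge is missing, both values of \<open>D\<close> in \<open>g\<close> are at least the total residual
  degree \<open>2\<close>.\<close>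

lemma g_val_neg:
  assumes "finite W" "H \<subseteq> complete_graph W" "L \<subseteq> complete_graph W"
    and "E \<in> complete_graph W" "E \<notin> H" "E \<notin> L"
    and "graphs_with_degrees W d H L \<noteq> {}"
    and "num_edges W d = real (card H) + 1"
  shows "g_val W d H L E < 0"
proof -
  obtain u v where E: "E = {u, v}" "u \<in> W" "v \<in> W" "u \<noteq> v"
    using assms(4) by (rule complete_graphE)
  interpret edge_switching W d H L u v
    using assms E by unfold_locales auto
  obtain G where G: "G \<in> all_graphs"
    using assms(7) by (auto simp: all_graphs_def)
  define \<alpha> where "\<alpha> = alpha_value W d (\<lambda>v. int (deg L v)) d (\<lambda>v. int (deg H v))"
  have arcs: "arc_count = 2"
    using assms(8) by (simp add: arc_count_def)
  have "2 \<le> \<alpha> u + 2" "2 \<le> \<alpha> v + 2"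
    using sum_sum_blocked_le(2)[OF G] u_in_W v_in_W by (simp_all add: \<alpha>_def)
  then have "2 \<le> deg_sum_residual W d H (\<alpha> u + 2)" "2 \<le> deg_sum_residual W d H (\<alpha> v + 2)"
    using two_le_deg_sum_residual[OF G] arcs by simp_all
  then show ?thesis
    using E arcs by (simp add: g_val_def \<alpha>_def arc_count_def[symmetric])
qed

section \<open>Comparing the product of the factors 1 + q_i with a power of phi\<close>

lemma prod_le_mean_power:
  fixes a :: "'b \<Rightarrow> real"
  assumes "finite S" "S \<noteq> {}" "\<And>i. i \<in> S \<Longrightarrow> 0 \<le> a i"
  shows "(\<Prod>i\<in>S. a i) \<le> ((\<Sum>i\<in>S. a i) / real (card S)) ^ card S"
proof -
  have card: "0 < card S"
    using assms by (simp add: card_gt_0_iff)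
  have nonneg: "0 \<le> (\<Prod>i\<in>S. a i)"
    using assms(3) by (rule prod_nonneg)
  have "(\<Prod>i\<in>S. a i) = ((\<Prod>i\<in>S. a i) powr (1 / real (card S))) ^ card S"
    using card nonneg by (cases "(\<Prod>i\<in>S. a i) = 0") (simp_all add: powr_powr flip: powr_realpow')
  also have "\<dots> \<le> ((\<Sum>i\<in>S. a i) / real (card S)) ^ card S"
    using arith_geom_mean[OF assms] by (intro power_mono) (simp_all add: sum_divide_distrib)
  finally show ?thesis .
qed

text \<open>If \<open>m(X) = m(G)\<close>, then \<open>\<phi>\<close> has the junk value \<open>1\<close>.\<close>

lemma prod_edge_ratio_le_phi:
  assumes "finite W" "X \<subseteq> complete_graph W" "bij_betw e {1..card X} X"
    and "real (card X) < num_edges W d"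
    and le: "\<And>w. w \<in> W \<Longrightarrow> int (deg X w) \<le> d w"
  shows "(\<Prod>i=1..card X. 1 + edge_ratio W d (e ` {1..i - 1}) (e i)) \<le> phi_val W d X ^ card X"
proof (cases "card X = 0")
  case False
  let ?m = "card X" and ?M = "2 * num_edges W d - 2 * real (card X)"
  have finX: "finite X"
    using False card_ge_0_finite by blast
  have q: "0 \<le> edge_ratio W d (e ` {1..i - 1}) (e i) \<and>
      edge_ratio W d (e ` {1..i - 1}) (e i) \<le> (\<Prod>w\<in>e i. real_of_int (d w)) / ?M"
    if i: "i \<in> {1..?m}" for i
  proof -
    let ?H = "e ` {1..i - 1}"
    have "X = e ` {1..?m}"
      using assms(3) by (simp add: bij_betw_def)
    moreover have "{1..i - 1} \<subseteq> {1..?m}"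
      using i by auto
    ultimately have "e i \<in> X" "?H \<subseteq> X"
      using i by blast+
    then have "e i \<subseteq> W"
      using assms(2) by (auto simp: complete_graph_def)
    have degs: "0 \<le> d w - int (deg ?H w)" if "w \<in> e i" for w
      using le[of w] deg_mono[OF finX \<open>?H \<subseteq> X\<close>, of w] that \<open>e i \<subseteq> W\<close> by auto
    have "card ?H \<le> ?m"
      using card_mono[OF finX \<open>?H \<subseteq> X\<close>] .
    then have M: "0 < ?M" "?M \<le> 2 * num_edges W d - 2 * real (card ?H)"
      using assms(4) by auto
    \<comment> \<open>The residual degrees lie between 0 and d_w because \<open>?H\<close> is part
      of X and X respects d; nonnegativity lets the comparison of factors pass to products.\<close>
    have num: "0 \<le> (\<Prod>w\<in>e i. real_of_int (d w - int (deg ?H w)))"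
      "(\<Prod>w\<in>e i. real_of_int (d w - int (deg ?H w))) \<le> (\<Prod>w\<in>e i. real_of_int (d w))"
      using degs by (force intro!: prod_nonneg, force intro!: prod_mono)
    show ?thesis
      unfolding edge_ratio_def
      using num M by (intro conjI divide_nonneg_nonneg frac_le) linarith+
  qed
  let ?q = "\<lambda>i. edge_ratio W d (e ` {1..i - 1}) (e i)"
  have "(\<Prod>i=1..?m. 1 + ?q i) \<le> ((\<Sum>i=1..?m. 1 + ?q i) / real (card {1..?m})) ^ card {1..?m}"
    using False q by (intro prod_le_mean_power) auto
  also have "\<dots> = ((\<Sum>i=1..?m. 1 + ?q i) / real ?m) ^ ?m"
    by simp
  also have "\<dots> \<le> phi_val W d X ^ ?m"
  proof (rule power_mono)
    have "(\<Sum>i=1..?m. 1 + ?q i) \<le> (\<Sum>i=1..?m. 1 + (\<Prod>w\<in>e i. real_of_int (d w)) / ?M)"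
      using q by (intro sum_mono) simp
    also have "\<dots> = real ?m + (\<Sum>i=1..?m. \<Prod>w\<in>e i. real_of_int (d w)) / ?M"
      by (simp add: sum.distrib sum_divide_distrib)
    also have "(\<Sum>i=1..?m. \<Prod>w\<in>e i. real_of_int (d w)) = (\<Sum>E\<in>X. \<Prod>w\<in>E. real_of_int (d w))"
      using assms(3) by (rule sum.reindex_bij_betw)
    finally have "(\<Sum>i=1..?m. 1 + ?q i) / real ?m
        \<le> (real ?m + (\<Sum>E\<in>X. \<Prod>w\<in>E. real_of_int (d w)) / ?M) / real ?m"
      by (rule divide_right_mono) simp
    also have "\<dots> = phi_val W d X"
      using False by (simp add: phi_val_def add_divide_distrib)
    finally show "(\<Sum>i=1..?m. 1 + ?q i) / real ?m \<le> phi_val W d X" .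
    show "0 \<le> (\<Sum>i=1..?m. 1 + ?q i) / real ?m"
      using q by (intro divide_nonneg_nonneg sum_nonneg add_nonneg_nonneg) auto
  qed
  finally show ?thesis .
qed simp

lemma graphs_with_degrees_antimono:
  "X \<subseteq> Y \<Longrightarrow> graphs_with_degrees W d Y L \<subseteq> graphs_with_degrees W d X L"
  by (auto simp: graphs_with_degrees_def)

theorem mainTheorem2:
  fixes W :: "'a set" and d :: "'a \<Rightarrow> int" and X L :: "'a set set" and e :: "nat \<Rightarrow> 'a set"
  assumes "finite W"
    and "X \<subseteq> complete_graph W" and "L \<subseteq> complete_graph W" and "X \<inter> L = {}"
    and "graphs_with_degrees W d {} L \<noteq> {}"
    and "bij_betw e {1..card X} X"
  shows "((\<forall>i\<in>{1..card X}. f_val W d (e ` {1..i - 1}) L (e i) > 0) \<longrightarrow>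
           measure_pmf.prob (pmf_of_set (graphs_with_degrees W d {} L)) {G. X \<subseteq> G}
             \<le> (\<Prod>j\<in>W. falling_fact (real_of_int (d j)) (deg X j))
                 / (2 ^ card X * falling_fact (num_edges W d) (card X))
               * (\<Prod>i=1..card X. 1 / f_val W d (e ` {1..i - 1}) L (e i)))
       \<and> ((\<forall>i\<in>{1..card X}. g_val W d (e ` {1..i - 1}) L (e i) > 0) \<longrightarrow>
           measure_pmf.prob (pmf_of_set (graphs_with_degrees W d {} L)) {G. X \<subseteq> G}
             \<ge> (\<Prod>j\<in>W. falling_fact (real_of_int (d j)) (deg X j))
                 / (2 ^ card X * falling_fact (num_edges W d) (card X))
               * (\<Prod>i=1..card X. g_val W d (e ` {1..i - 1}) L (e i) / phi_val W d X))"
proof -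
  let ?m = "card X"
  define \<G> where "\<G> H = graphs_with_degrees W d H L" for H
  define X' where "X' n = e ` {1..n}" for n
  define q where "q i = edge_ratio W d (X' (i - 1)) (e i)" for i
  define f where "f i = f_val W d (X' (i - 1)) L (e i)" for i
  define g where "g i = g_val W d (X' (i - 1)) L (e i)" for i
  define p where "p = measure_pmf.prob (pmf_of_set (\<G> {})) {G. X \<subseteq> G}"

  have finX: "finite X"
    using assms(1,2) finite_complete_graph finite_subset by blast
  have X'_0: "X' 0 = {}"
    by (simp add: X'_def)
  have X'_m: "X' ?m = X"
    using assms(6) by (simp add: X'_def bij_betw_def)
  have X'_Suc: "X' (Suc n) = insert (e (Suc n)) (X' n)" for n
    by (simp add: X'_def atLeastAtMostSuc_conv)
  have step: "X' n \<subseteq> X" "e (Suc n) \<in> X" "e (Suc n) \<notin> X' n" "card (X' n) = n" if "Suc n \<le> ?m" for n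
  proof -
    have inj: "inj_on e {1..?m}" and img: "e ` {1..?m} = X"
      using assms(6) by (auto simp: bij_betw_def)
    show "X' n \<subseteq> X" "e (Suc n) \<in> X"
      using that img by (auto simp: X'_def)
    show "e (Suc n) \<notin> X' n"
      using that inj by (auto simp: X'_def dest: inj_onD)
    show "card (X' n) = n"
      using that inj by (simp add: X'_def card_image inj_on_subset)
  qed
  have edge: "X' n \<subseteq> complete_graph W" "e (Suc n) \<in> complete_graph W" "e (Suc n) \<subseteq> W"
    "e (Suc n) \<notin> L" "finite (X' n)" if "Suc n \<le> ?m" for n
    using step[OF that] assms(2,4) finX finite_subset by (auto simp: complete_graph_def)
  have ratio: "deg_ratio W d (X' n) = (\<Prod>i=1..n. q i)" if "n \<le> ?m" for n
    using that
  proof (induction n)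
    case (Suc n)
    then show ?case
      using deg_ratio_insert[OF assms(1), of "X' n" "e (Suc n)" d] step(3)[of n] edge[of n]
      by (simp add: X'_Suc q_def)
  qed (simp add: X'_0 deg_ratio_empty)

  have fin: "finite (\<G> H)" for H
    unfolding \<G>_def using assms(1) by (rule finite_graphs_with_degrees)
  have card0: "0 < real (card (\<G> {}))"
    using assms(5) fin by (simp add: card_gt_0_iff \<G>_def)
  have "p = real (card (\<G> {} \<inter> {G. X \<subseteq> G})) / real (card (\<G> {}))"
    unfolding p_def by (rule measure_pmf_of_set) (use assms(5) fin in \<open>auto simp: \<G>_def\<close>)
  also have "\<G> {} \<inter> {G. X \<subseteq> G} = \<G> X"
    by (auto simp: \<G>_def graphs_with_degrees_def)
  finally have p: "p = real (card (\<G> X)) / real (card (\<G> {}))" .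

  \<comment> \<open>Any admissible graph shows that m(G) and the d_w are natural numbers, so the
    sign and zero criteria for falling factorials apply.\<close>
  obtain G0 where G0: "G0 \<in> \<G> {}"
    using assms(5) by (auto simp: \<G>_def)
  have m: "num_edges W d = real (card G0)"
    using G0 assms(1) num_edges_eq unfolding \<G>_def by blast
  have d_eq: "d w = int (deg G0 w)" if "w \<in> W" for w
    using G0 that by (simp add: \<G>_def graphs_with_degrees_def)

  have "p \<le> deg_ratio W d X * (\<Prod>i=1..?m. 1 / f i)" if f_pos: "\<forall>i\<in>{1..?m}. 0 < f i"
  proof (cases "\<G> X = {}")
    \<comment> \<open>Here p = 0 and a nonnegative right-hand side suffices. The induction in the
      other case needs graphs containing each intermediate X_i; those containing X provide
      them.\<close>
    case True
    have "0 \<le> deg_ratio W d X"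
      using d_eq by (auto simp: deg_ratio_def m falling_fact_nonneg
          intro!: divide_nonneg_nonneg prod_nonneg)
    then show ?thesis
      using f_pos True by (auto simp: p less_imp_le intro!: mult_nonneg_nonneg prod_nonneg)
  next
    case False
    have "real (card (\<G> (X' n))) \<le> real (card (\<G> {})) * (\<Prod>i=1..n. q i * (1 / f i))"
      if "n \<le> ?m" for n
      using that
    proof (induction n)
      case (Suc n)
      have ne: "\<G> (insert (e (Suc n)) (X' n)) \<noteq> {}"
        using False graphs_with_degrees_antimono[of "insert (e (Suc n)) (X' n)" X W d L]
          step[OF Suc.prems] by (auto simp: \<G>_def)
      note edge_facts = assms(1) edge(1)[OF Suc.prems] assms(3) edge(2)[OF Suc.prems]
        step(3)[OF Suc.prems] edge(4)[OF Suc.prems]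
      have f_Suc: "0 < f_val W d (X' n) L (e (Suc n))"
        using f_pos Suc.prems by (auto simp: f_def dest!: bspec[of _ _ "Suc n"])
      have q_Suc: "0 \<le> q (Suc n) * (1 / f (Suc n))"
        using edge_ratio_nonneg[OF edge_facts ne[unfolded \<G>_def] f_Suc] f_Suc
        by (simp add: q_def f_def)
      have "real (card (\<G> (X' (Suc n)))) \<le> real (card (\<G> (X' n))) * (q (Suc n) * (1 / f (Suc n)))"
        using card_insert_le[OF edge_facts ne[unfolded \<G>_def] f_Suc]
        by (simp add: \<G>_def X'_Suc q_def f_def)
      also have "\<dots> \<le> real (card (\<G> {})) * (\<Prod>i=1..n. q i * (1 / f i)) * (q (Suc n) * (1 / f (Suc n)))"
        using Suc by (intro mult_right_mono q_Suc) simp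
      finally show ?case
        by (simp add: mult.assoc)
    qed (simp add: X'_0)
    from this[of ?m] have "real (card (\<G> X)) \<le> real (card (\<G> {})) * (\<Prod>i=1..?m. q i * (1 / f i))"
      by (simp add: X'_m)
    then have "p \<le> (\<Prod>i=1..?m. q i * (1 / f i))"
      using card0 by (simp add: p pos_divide_le_eq mult.commute)
    also have "\<dots> = deg_ratio W d X * (\<Prod>i=1..?m. 1 / f i)"
      using ratio[of ?m] by (simp only: prod.distrib X'_m order_refl)
    finally show ?thesis .
  qed
  moreover
  have "deg_ratio W d X * (\<Prod>i=1..?m. g i / phi_val W d X) \<le> p" if g_pos: "\<forall>i\<in>{1..?m}. 0 < g i"
  proof (cases "deg_ratio W d X = 0")
    case True
    then show ?thesis
      by (simp add: p)
  next
    case False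
    \<comment> \<open>A quotient with denominator 0 is 0, so a nonzero value excludes zeros both
      above and below the line: m(X) \<le> m(G) and x_w \<le> d_w follow.\<close>
    have m_le: "?m \<le> card G0"
      using False by (auto simp: deg_ratio_def m falling_fact_eq_0_iff)
    have d_le: "int (deg X w) \<le> d w" if "w \<in> W" for w
    proof -
      have "falling_fact (real (deg G0 w)) (deg X w) \<noteq> 0"
        using False that assms(1) d_eq[OF that] by (auto simp: deg_ratio_def)
      then show ?thesis
        using d_eq[OF that] by (simp add: falling_fact_eq_0_iff)
    qed
    \<comment> \<open>The next edge is still to be counted at its ends, so there the degree in X_n
      is strictly below x_w, hence below d_w.\<close>
    have q_pos: "0 < q (Suc n)" if "Suc n \<le> ?m" for n
    proof -
      have "deg (X' n) w < deg X w" if "w \<in> e (Suc n)" for w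
        using deg_mono[OF finX, of "X' (Suc n)" w] deg_insert[of "X' n" "e (Suc n)" w]
          step[OF \<open>Suc n \<le> ?m\<close>] edge[OF \<open>Suc n \<le> ?m\<close>] that by (simp add: X'_Suc)
      then have "0 < (\<Prod>w\<in>e (Suc n). real_of_int (d w - int (deg (X' n) w)))"
        using d_le edge(3)[OF that] by (intro prod_pos) force
      moreover have "n < card G0"
        using that m_le by simp
      ultimately show ?thesis
        by (simp add: q_def edge_ratio_def m step(4)[OF that])
    qed
    have factor_pos: "0 < q (Suc n) * g (Suc n) / (1 + q (Suc n))" if "Suc n \<le> ?m" for n
      using q_pos[OF that] g_pos that by simp
    have lower: "real (card (\<G> {})) * (\<Prod>i=1..n. q i * g i / (1 + q i)) \<le> real (card (\<G> (X' n)))"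
      if "n \<le> ?m" for n
      using that
    proof (induction n)
      case (Suc n)
      have "real (card (\<G> {})) * (\<Prod>i=1..n. q i * g i / (1 + q i))
          * (q (Suc n) * g (Suc n) / (1 + q (Suc n)))
        \<le> real (card (\<G> (X' n))) * (q (Suc n) * g (Suc n) / (1 + q (Suc n)))"
        using Suc factor_pos[of n] by (intro mult_right_mono) auto
      also have "\<dots> \<le> real (card (\<G> (X' (Suc n))))"
      proof -
        have "real (card (X' n)) < num_edges W d"
          using step(4)[OF Suc.prems] Suc.prems m_le m by simp
        moreover have "0 \<le> edge_ratio W d (X' n) (e (Suc n))"
          using q_pos[OF Suc.prems] by (simp add: q_def)
        ultimately show ?thesis
          using card_insert_ge[OF assms(1) edge(1)[OF Suc.prems] assms(3) edge(2)[OF Suc.prems]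
            step(3)[OF Suc.prems] edge(4)[OF Suc.prems], of d]
          by (simp add: \<G>_def X'_Suc q_def g_def)
      qed
      finally show ?case
        by (simp add: mult.assoc)
    qed (simp add: X'_0)
    have "?m < card G0" if "0 < ?m"
    proof (rule ccontr)
      assume "\<not> ?m < card G0"
      then have "card G0 = ?m"
        using m_le by simp
      moreover obtain n where "?m = Suc n"
        using gr0_implies_Suc[OF \<open>0 < ?m\<close>] by blast
      ultimately have n: "?m = Suc n" "card G0 = Suc n"
        by simp_all
      \<comment> \<open>The lower bound for all edges but the last is already positive, so some
        graph contains them. Only one edge is then missing, and \<open>g_val_neg\<close> contradicts
        the hypothesis on the last g.\<close>
      have "0 < (\<Prod>i=1..n. q i * g i / (1 + q i))"
      proof (rule prod_pos)
        fix i assume "i \<in> {1..n}"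
        then show "0 < q i * g i / (1 + q i)"
          using factor_pos[of "i - 1"] n by simp
      qed
      then have "0 < real (card (\<G> {})) * (\<Prod>i=1..n. q i * g i / (1 + q i))"
        using card0 by (rule mult_pos_pos[rotated])
      also have "\<dots> \<le> real (card (\<G> (X' n)))"
        using lower n by simp
      finally have "\<G> (X' n) \<noteq> {}"
        by auto
      then have "g (Suc n) < 0"
        unfolding g_def diff_Suc_1 \<G>_def using n m step(4)[of n]
        by (intro g_val_neg assms(1,3) edge step) auto
      then show False
        using bspec[OF g_pos, of "Suc n"] n by simp
    qed
    then have phi: "(\<Prod>i=1..?m. 1 + q i) \<le> phi_val W d X ^ ?m"
      using prod_edge_ratio_le_phi[OF assms(1,2,6), of d] d_le m
      by (cases "?m = 0") (simp_all add: q_def X'_def)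
    have one_le: "0 < (\<Prod>i=1..?m. 1 + q i)"
    proof (rule prod_pos)
      fix i assume "i \<in> {1..?m}"
      then show "0 < 1 + q i"
        using q_pos[of "i - 1"] by simp
    qed
    have "0 \<le> (\<Prod>i=1..?m. q i * g i)"
    proof (rule prod_nonneg)
      fix i assume "i \<in> {1..?m}"
      then show "0 \<le> q i * g i"
        using q_pos[of "i - 1"] g_pos by (auto simp: less_imp_le intro!: mult_nonneg_nonneg)
    qed
    then have "(\<Prod>i=1..?m. q i * g i) / phi_val W d X ^ ?m
        \<le> (\<Prod>i=1..?m. q i * g i) / (\<Prod>i=1..?m. 1 + q i)"
      using phi one_le by (intro divide_left_mono) auto
    also have "\<dots> \<le> p"
      using lower[of ?m] card0 by (simp add: p X'_m prod_dividef pos_le_divide_eq mult.commute)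
    also have "(\<Prod>i=1..?m. q i * g i) / phi_val W d X ^ ?m
        = deg_ratio W d X * (\<Prod>i=1..?m. g i / phi_val W d X)"
      using ratio[of ?m] by (simp add: prod.distrib prod_dividef X'_m)
    finally show ?thesis .
  qed
  ultimately show ?thesis
    unfolding deg_ratio_def f_def g_def X'_def p_def \<G>_def by blast
qed

end
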